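(* Consider the Bradley–Terry–Luce (BTL) model with parameter $\boldsymbol\theta^*=(\theta_1^*,\dots,\theta_n^* )^\top$ such that $\mathbf 1_n^\top\boldsymbol\theta^*=0$, and a comparison graph $\mathcal G=\mathcal G([n],E)$ with adjacency matrix $\mathbf A$, algebraic connectivity $\lambda_2=\lambda_2(\mathcal L_{\mathbf A})$ and maximum and minimum degrees $n_{\max}$ and $n_{\min}$. Suppose that each pair of items $(i,j)\in E$ is compared $L$ times. Let $\kappa=\max_{i,j}|\theta_i^*-\theta_j^*|$, $\kappa_E=\max_{(i,j)\in E}|\theta_i^*-\theta_j^*|$, $r=\kappa_E+\log\kappa$, and set $\rho\ge c_\rho\,\kappa^{-2}e^{-2.5\kappa_E}n^{-4}n_{\max}^{1/2}$. Assume that $\mathcal G$ is connected, i.e. $\lambda_2(\mathcal L_{\mathbf A})>0$. Assume also that $L\le n^8e^{5\kappa_E}\max\{1,\kappa\}$ and that $L$ is large enough so that the right hand side of the $\ell_\infty$ bound (1) below is smaller than a sufficiently small constant $C>0$. Then with probability at least $1-O(n^{-4})$ the regularized MLE $\hat{\boldsymbol\theta}_\rho$ satisfies $$\|\hat{\boldsymbol\theta}_\rho-\boldsymbol\theta^*\|_\infty\lesssim \frac{e^{2\kappa_E}}{\lambda_2}\frac{n_{\max}}{n_{\min}}\left(\sqrt{\frac{n+r}{L}}+\rho\kappa\sqrt{\frac{n}{n_{\max}}}\right)+\frac{e^{\kappa_E}}{\lambda_2}\sqrt{\frac{n_{\max}(\log n+r)}{L}},\qquad(1)$$ $$\|\hat{\boldsymbol\theta}_\rho-\boldsymbol\theta^*\|_2\lesssim\frac{e^{\kappa_E}}{\lambda_2}\left(\sqrt{\frac{n_{\max}(n+r)}{L}}+\rho\kappa\sqrt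 n\right).$$ In particular, if $\rho=\frac{c_\rho}{\kappa}\sqrt{\frac{n_{\max}}{L}}$ for some $c_\rho>0$, then $$\|\hat{\boldsymbol\theta}_\rho-\boldsymbol\theta^*\|_\infty\lesssim\frac{e^{2\kappa_E}}{\lambda_2}\frac{n_{\max}}{n_{\min}}\sqrt{\frac{n+r}{L}}+\frac{e^{\kappa_E}}{\lambda_2}\sqrt{\frac{n_{\max}(\log n+r)}{L}},\qquad \|\hat{\boldsymbol\theta}_\rho-\boldsymbol\theta^*\|_2\lesssim\frac{e^{\kappa_E}}{\lambda_2}\sqrt{\frac{n_{\max}(n+r)}{L}}.$$
   Context: The comparison graph $\mathcal G([n],E)$ is an undirected simple graph on $[n]=\{1,\dots,n\}$ with adjacency matrix $\mathbf A=(A_{ij})$, $A_{ij}=1\{(i,j)\in E\}$. Node degrees are $n_i=\sum_jA_{ij}$, with $n_{\max}=\max_in_i$ and $n_{\min}=\min_in_i$. The graph Laplacian is $\mathcal L_{\mathbf A}=\mathrm{diag}(n_1,\dots,n_n)-\mathbf A$, and $\lambda_2(\mathcal L_{\mathbf A})$ is its second smallest eigenvalue. BTL model: for each edge $(i,j)\in E$, $i<j$, one observes independent $y_{ij}^{(l)}\in\{0,1\}$, $l=1,\dots,L$ (1 meaning $i$ beats $j$), with $\Pr(y_{ij}^{(l)}=1)=\psi(\theta_i^*-\theta_j^* )$, where $\psi(t)=1/(1+e^{-t})$; all comparisons are independent. Put $\bar y_{ij}=\frac1L\sum_{l=1}^Ly_{ij}^{(l)}$. The negative log-likelihood is $$\ell(\boldsymbol\theta;\mathbf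 y)=-\sum_{1\le i<j\le n}A_{ij}\left\{\bar y_{ij}\log\psi(\theta_i-\theta_j)+(1-\bar y_{ij})\log[1-\psi(\theta_i-\theta_j)]\right\},$$ and the $\ell_2$-regularized MLE is $\hat{\boldsymbol\theta}_\rho=\arg\min_{\mathbf 1_n^\top\boldsymbol\theta=0}\left\{\ell(\boldsymbol\theta;\mathbf y)+\frac\rho2\|\boldsymbol\theta\|_2^2\right\}$. $\mathbf 1_n$ is the all-ones vector. $x\lesssim y$ means $x\le cy$ for a constant $c>0$ not depending on $n$, $L$, $\mathcal G$, $\boldsymbol\theta^*$; likewise for $O(\cdot)$. $c_\rho>0$ denotes a fixed constant.
   Formalization: Here r = κ_E + log max{1,κ} instead of κ_E + log κ, and κ > 0 is explicit; for κ < 1 the literal r can make log n + r negative, and bound (1) fails, e.g. for complete graphs with κ = 1/n, L = n. *)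

theory Defs
  imports "HOL-Probability.Probability" "Jordan_Normal_Form.Char_Poly"
begin

unbundle no vec_syntax

text \<open>
  The items are numbered \<open>0, \<dots>, n - 1\<close> instead of \<open>1, \<dots>, n\<close>. An undirected simple graph on
  them is given by its adjacency relation, so every edge occurs in both orientations.
\<close>

definition simple_graph :: "nat \<Rightarrow> (nat \<times> nat) set \<Rightarrow> bool" where
  "simple_graph n E \<longleftrightarrow> E \<subseteq> {..<n} \<times> {..<n} \<and> sym E \<and> irrefl E"

definition adj_mat :: "nat \<Rightarrow> (nat \<times> nat) set \<Rightarrow> real mat" where
  "adj_mat n E = Matrix.mat n n (\<lambda>(i, j). of_bool ((i, j) \<in> E))"

definition node_degree :: "nat \<Rightarrow> (nat \<times> nat) set \<Rightarrow> nat \<Rightarrow> real" where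
  "node_degree n E i = (\<Sum>j<n. adj_mat n E $$ (i, j))"

definition max_degree :: "nat \<Rightarrow> (nat \<times> nat) set \<Rightarrow> real" where
  "max_degree n E = Max (node_degree n E ` {..<n})"

definition min_degree :: "nat \<Rightarrow> (nat \<times> nat) set \<Rightarrow> real" where
  "min_degree n E = Min (node_degree n E ` {..<n})"

definition laplacian :: "nat \<Rightarrow> (nat \<times> nat) set \<Rightarrow> real mat" where
  "laplacian n E =
     Matrix.mat n n (\<lambda>(i, j). if i = j then node_degree n E i else 0) - adj_mat n E"

text \<open>
  The eigenvalues are counted with algebraic multiplicity and listed in increasing order; the
  entry with index 1 is the second smallest one. It is meaningful for symmetric real matrices of
  dimension at least 2, whose characteristic polynomial splits over the reals.
\<close>

definition second_smallest_eigenvalue :: "real mat \<Rightarrow> real" where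
  "second_smallest_eigenvalue A = sorted_list_of_multiset (proots (char_poly A)) ! 1"

definition logistic :: "real \<Rightarrow> real" where
  "logistic t = 1 / (1 + exp (- t))"

definition comparisons :: "nat \<Rightarrow> (nat \<times> nat) set \<Rightarrow> nat \<Rightarrow> (nat \<times> nat \<times> nat) set" where
  "comparisons n E L = {(i, j, l). i < j \<and> j < n \<and> (i, j) \<in> E \<and> l < L}"

text \<open>
  The joint law of all outcomes; the value at \<open>(i, j, l)\<close> says whether \<open>i\<close> beats \<open>j\<close> in the
  \<open>l\<close>-th of their comparisons. \<^const>\<open>Pi_pmf\<close> makes the outcomes independent, and sets the
  function to \<^const>\<open>False\<close> at triples that are not comparisons.
\<close>

definition btl_pmf ::
    "nat \<Rightarrow> (nat \<times> nat) set \<Rightarrow> nat \<Rightarrow> real vec \<Rightarrow> (nat \<times> nat \<times> nat \<Rightarrow> bool) pmf" where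
  "btl_pmf n E L \<theta> =
     Pi_pmf (comparisons n E L) False (\<lambda>(i, j, l). bernoulli_pmf (logistic (\<theta> $ i - \<theta> $ j)))"

definition mean_outcome :: "nat \<Rightarrow> (nat \<times> nat \<times> nat \<Rightarrow> bool) \<Rightarrow> nat \<Rightarrow> nat \<Rightarrow> real" where
  "mean_outcome L y i j = (1 / real L) * (\<Sum>l<L. of_bool (y (i, j, l)))"

definition neg_log_likelihood ::
    "nat \<Rightarrow> (nat \<times> nat) set \<Rightarrow> nat \<Rightarrow> (nat \<times> nat \<times> nat \<Rightarrow> bool) \<Rightarrow> real vec \<Rightarrow> real" where
  "neg_log_likelihood n E L y \<theta> =
     - (\<Sum>j<n. \<Sum>i<j. adj_mat n E $$ (i, j) *
          (mean_outcome L y i j * ln (logistic (\<theta> $ i - \<theta> $ j)) +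
           (1 - mean_outcome L y i j) * ln (1 - logistic (\<theta> $ i - \<theta> $ j))))"

definition centered_vecs :: "nat \<Rightarrow> real vec set" where
  "centered_vecs n = {\<theta> \<in> carrier_vec n. vec n (\<lambda>_. 1) \<bullet> \<theta> = 0}"

definition l2_norm :: "real vec \<Rightarrow> real" where
  "l2_norm v = sqrt (v \<bullet> v)"

definition linf_norm :: "real vec \<Rightarrow> real" where
  "linf_norm v = Max ((\<lambda>i. \<bar>v $ i\<bar>) ` {..<dim_vec v})"

text \<open>
  For \<open>\<rho> > 0\<close> the objective is continuous, strictly convex and coercive, so that the minimizer
  chosen by \<^const>\<open>arg_min_on\<close> exists and is unique.
\<close>

definition reg_mle ::
    "nat \<Rightarrow> (nat \<times> nat) set \<Rightarrow> nat \<Rightarrow> real \<Rightarrow> (nat \<times> nat \<times> nat \<Rightarrow> bool) \<Rightarrow> real vec" where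
  "reg_mle n E L \<rho> y =
     arg_min_on (\<lambda>\<theta>. neg_log_likelihood n E L y \<theta> + \<rho> / 2 * (l2_norm \<theta>)\<^sup>2) (centered_vecs n)"

definition dyn_range :: "nat \<Rightarrow> real vec \<Rightarrow> real" where
  "dyn_range n \<theta> = Max ((\<lambda>(i, j). \<bar>\<theta> $ i - \<theta> $ j\<bar>) ` ({..<n} \<times> {..<n}))"

definition edge_range :: "(nat \<times> nat) set \<Rightarrow> real vec \<Rightarrow> real" where
  "edge_range E \<theta> = Max ((\<lambda>(i, j). \<bar>\<theta> $ i - \<theta> $ j\<bar>) ` E)"

text \<open>
  The quantity \<open>r = \<kappa>\<^sub>E + log \<kappa>\<close>. The logarithm is truncated at 0: for \<open>\<kappa> < 1\<close> the numbers
  \<open>log n + r\<close> and \<open>n + r\<close> under the square roots of the bounds could otherwise be negative, and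
  the uniform bound would fail, e.g. for complete graphs with \<open>\<kappa> = 1 / n\<close> and \<open>L = n\<close>.
\<close>

definition range_term :: "real \<Rightarrow> real \<Rightarrow> real" where
  "range_term \<kappa> \<kappa>\<^sub>E = \<kappa>\<^sub>E + ln (max 1 \<kappa>)"

end

theory Submission
  imports Defs
begin

text \<open>
  Write \<open>\<delta>\<close> for the estimation error, \<open>g\<close> for the negative gradient of the regularised objective at the true
  parameter (noise plus shrinkage \<open>- \<rho> \<theta>\<close>), and \<open>D i j\<close> for the difference of the two win probabilities of the
  pair \<open>(i, j)\<close> under the estimate and under the truth. Stationarity of the estimate says that at every item
  \<open>i\<close> the flow \<open>\<Sum>j\<sim>i. D i j\<close> plus \<open>\<rho> \<delta> i\<close> equals \<open>g i\<close>. The logistic function has slope at least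
  \<open>exp (- \<kappa>\<^sub>E) / 12\<close> on average over any step of length at most 1 from a true edge difference, so that \<open>D i j\<close>
  is at least \<open>\<beta> min (\<delta> i - \<delta> j) 1\<close> with \<open>\<beta> = exp (- \<kappa>\<^sub>E) / 12\<close> whenever \<open>\<delta> j \<le> \<delta> i\<close>. Everything follows from these
  balance equations and from two norms of \<open>g\<close>.

  Pairing the balance equations with \<open>\<delta>\<close> and using that the Dirichlet form dominates \<open>\<lambda>\<^sub>2\<close> times the squared
  norm on centred vectors gives \<open>\<parallel>\<delta>\<parallel>\<^sub>2 \<le> T \<parallel>g\<parallel>\<^sub>2 / (\<beta> \<lambda>\<^sub>2)\<close>, where \<open>T\<close> is 2 if all \<open>\<bar>\<delta> i\<bar>\<close>
  are below 1, and \<open>2 M\<close> if the largest of them is \<open>M \<ge> 1\<close>. The second possibility leads to a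
  contradiction: at the item \<open>m\<close> where \<open>M\<close> is attained, the Euclidean bound leaves fewer
  than half of the neighbours with an error above \<open>M / 2\<close>; every other neighbour contributes at least
  \<open>\<beta> / 2\<close> to the flow at \<open>m\<close>, which then exceeds \<open>g m\<close>. This is where the smallness of the right-hand
  side of the uniform bound is used. Once \<open>M < 1\<close>, the balance equation at \<open>m\<close> alone compares \<open>M\<close> with the
  mean error of its neighbours, and Cauchy-Schwarz gives
  \<open>M \<le> \<parallel>\<delta>\<parallel>\<^sub>2 / sqrt (deg m) + 2 \<bar>g m\<bar> / (\<beta> deg m)\<close>
  (lemmas \<open>balanced_l2_bound\<close> and \<open>balanced_error_bounds\<close>). Together with \<open>\<lambda>\<^sub>2 \<le> 2 n\<^sub>m\<^sub>i\<^sub>n\<close> this is at most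
  a constant times the stated rate.

  The randomness enters only through \<open>g\<close> (lemma \<open>score_concentration\<close>). Linear forms of the score are
  sub-Gaussian by Hoeffding's lemma, with variance proxy the Dirichlet form of the coefficients divided by
  \<open>4 L\<close>. A Chernoff bound controls each coordinate. For the Euclidean norm, integrating the moment generating
  function over Gaussian coefficients turns linear forms into the squared norm; so the norm is of order
  \<open>sqrt (n n\<^sub>m\<^sub>a\<^sub>x / L)\<close>, without a logarithmic factor, up to probability \<open>exp (- n)\<close>.

  The algebraic connectivity is defined by the second entry of the sorted list of roots of the characteristic
  polynomial. It is tied to the Dirichlet form by minimising the form over centred unit vectors: the minimum
  \<open>\<mu>\<close> is an eigenvalue with an eigenvector that is not constant, whence \<open>x (x - \<mu>)\<close> divides the
  characteristic polynomial, also when \<open>\<mu> = 0\<close>, and the second root is at most \<open>\<mu>\<close>.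
\<close>

section \<open>The Dirichlet form of a graph\<close>

lemma sum_square_eq_sum_triangle:
  fixes f :: "nat \<Rightarrow> nat \<Rightarrow> 'a::comm_monoid_add"
  assumes "\<And>i. i < n \<Longrightarrow> f i i = 0"
  shows "(\<Sum>i<n. \<Sum>j<n. f i j) = (\<Sum>j<n. \<Sum>i<j. f i j + f j i)"
  using assms
proof (induction n)
  case (Suc n)
  have "(\<Sum>i<Suc n. \<Sum>j<Suc n. f i j)
      = (\<Sum>i<n. \<Sum>j<n. f i j) + (\<Sum>i<n. f i n) + ((\<Sum>j<n. f n j) + f n n)"
    by (simp add: sum.distrib ac_simps)
  with Suc show ?case by (simp add: sum.distrib ac_simps)
qed simp

definition adj :: "(nat \<times> nat) set \<Rightarrow> nat \<Rightarrow> nat \<Rightarrow> real" where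
  "adj E i j = of_bool ((i, j) \<in> E)"

text \<open>
  The quadratic form of the graph Laplacian. It is a sum over unordered pairs, like the likelihood;
  \<open>dirichlet_eq\<close> below is the form \<open>x\<^sup>T \<L> x\<close>.
\<close>

definition dirichlet :: "nat \<Rightarrow> (nat \<times> nat) set \<Rightarrow> (nat \<Rightarrow> real) \<Rightarrow> real" where
  "dirichlet n E x = (\<Sum>j<n. \<Sum>i<j. adj E i j * (x i - x j)\<^sup>2)"

lemma adj_nonneg [simp]: "0 \<le> adj E i j" and adj_le_1: "adj E i j \<le> 1"
  by (simp_all add: adj_def)

lemma adj_sq [simp]: "(adj E i j)\<^sup>2 = adj E i j"
  by (simp add: adj_def)

lemma adj_sym: "simple_graph n E \<Longrightarrow> adj E i j = adj E j i"
  by (auto simp: adj_def simple_graph_def sym_def)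

lemma adj_loop: "simple_graph n E \<Longrightarrow> adj E i i = 0"
  by (auto simp: adj_def simple_graph_def irrefl_def)

lemma adj_mat_index: "i < n \<Longrightarrow> j < n \<Longrightarrow> adj_mat n E $$ (i, j) = adj E i j"
  by (simp add: adj_mat_def adj_def)

lemma node_degree_eq: "i < n \<Longrightarrow> node_degree n E i = (\<Sum>j<n. adj E i j)"
  unfolding node_degree_def by (intro sum.cong) (simp_all add: adj_mat_index)

text \<open>
  Discrete integration by parts: the contributions of \<open>(i, j)\<close> and \<open>(j, i)\<close> to the left-hand side merge
  into one. Every passage between gradients, which live on items, and sums over compared pairs rests on it.
\<close>

lemma sum_antisymmetric_pairing:
  fixes R :: "nat \<Rightarrow> nat \<Rightarrow> real"
  assumes "\<And>i j. i < n \<Longrightarrow> j < n \<Longrightarrow> R i j = - R j i"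
  shows "(\<Sum>i<n. u i * (\<Sum>j<n. R i j)) = (\<Sum>j<n. \<Sum>i<j. R i j * (u i - u j))"
proof -
  have "(\<Sum>i<n. u i * (\<Sum>j<n. R i j)) = (\<Sum>i<n. \<Sum>j<n. u i * R i j)"
    by (simp add: sum_distrib_left)
  also have "\<dots> = (\<Sum>j<n. \<Sum>i<j. u i * R i j + u j * R j i)"
  proof (rule sum_square_eq_sum_triangle)
    fix i assume "i < n"
    then show "u i * R i i = 0" using assms[of i i] by simp
  qed
  also have "\<dots> = (\<Sum>j<n. \<Sum>i<j. R i j * (u i - u j))"
  proof (intro sum.cong refl)
    fix i j assume "j \<in> {..<n}" "i \<in> {..<j}"
    then have "R j i = - R i j" using assms[of j i] by simp
    then show "u i * R i j + u j * R j i = R i j * (u i - u j)" by (simp add: algebra_simps)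
  qed
  finally show ?thesis .
qed

lemma dirichlet_bilinear:
  assumes "simple_graph n E"
  shows "(\<Sum>i<n. u i * (\<Sum>j<n. adj E i j * (x i - x j)))
       = (\<Sum>j<n. \<Sum>i<j. adj E i j * ((x i - x j) * (u i - u j)))"
  by (subst sum_antisymmetric_pairing) (auto simp: adj_sym[OF assms] algebra_simps)

lemma dirichlet_eq:
  assumes "simple_graph n E"
  shows "dirichlet n E x = (\<Sum>i<n. x i * (\<Sum>j<n. adj E i j * (x i - x j)))"
  unfolding dirichlet_bilinear[OF assms] dirichlet_def by (simp add: power2_eq_square)

lemma dirichlet_nonneg: "0 \<le> dirichlet n E x"
  unfolding dirichlet_def by (intro sum_nonneg) simp

lemma dirichlet_add:
  assumes "simple_graph n E"
  shows "dirichlet n E (\<lambda>i. x i + t * v i)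
    = dirichlet n E x + 2 * t * (\<Sum>i<n. v i * (\<Sum>j<n. adj E i j * (x i - x j))) + t\<^sup>2 * dirichlet n E v"
proof -
  have *: "adj E i j * (x i + t * v i - (x j + t * v j))\<^sup>2 =
     adj E i j * (x i - x j)\<^sup>2 + 2 * t * (adj E i j * ((x i - x j) * (v i - v j)))
      + t\<^sup>2 * (adj E i j * (v i - v j)\<^sup>2)" for i j
    by (simp add: power2_eq_square algebra_simps)
  show ?thesis
    unfolding dirichlet_bilinear[OF assms] dirichlet_def *
    by (simp add: sum.distrib sum_distrib_left)
qed

text \<open>
  The Laplacian is at most twice the diagonal matrix of degrees, since \<open>(a - b)\<^sup>2 \<le> 2 a\<^sup>2 + 2 b\<^sup>2\<close>.
\<close>

lemma dirichlet_le_degrees: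
  assumes "simple_graph n E"
  shows "dirichlet n E u \<le> 2 * (\<Sum>i<n. node_degree n E i * (u i)\<^sup>2)"
proof -
  have "dirichlet n E u \<le> (\<Sum>j<n. \<Sum>i<j. 2 * (adj E i j * (u i)\<^sup>2) + 2 * (adj E j i * (u j)\<^sup>2))"
    unfolding dirichlet_def
  proof (intro sum_mono)
    fix i j
    have "(u i - u j)\<^sup>2 \<le> 2 * (u i)\<^sup>2 + 2 * (u j)\<^sup>2"
      using sum_squares_bound[of "u i" "- u j"] by (simp add: power2_eq_square algebra_simps)
    then have "adj E i j * (u i - u j)\<^sup>2 \<le> adj E i j * (2 * (u i)\<^sup>2 + 2 * (u j)\<^sup>2)"
      by (intro mult_left_mono) simp_all
    then show "adj E i j * (u i - u j)\<^sup>2 \<le> 2 * (adj E i j * (u i)\<^sup>2) + 2 * (adj E j i * (u j)\<^sup>2)"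
      using adj_sym[OF assms, of j i] by (simp add: algebra_simps)
  qed
  also have "\<dots> = (\<Sum>i<n. \<Sum>j<n. 2 * (adj E i j * (u i)\<^sup>2))"
    by (rule sum_square_eq_sum_triangle[symmetric]) (simp add: adj_loop[OF assms])
  also have "\<dots> = 2 * (\<Sum>i<n. node_degree n E i * (u i)\<^sup>2)"
    by (simp add: node_degree_eq sum_distrib_left sum_distrib_right)
  finally show ?thesis .
qed

text \<open>
  For \<open>s = 1\<close> and \<open>c = - 1 / n\<close> this is the test vector that compares \<open>\<lambda>\<^sub>2\<close> with a degree; for
  \<open>c = 0\<close> it is the variance proxy of a single coordinate of the score.
\<close>

lemma dirichlet_point:
  assumes "simple_graph n E" "m < n"
  shows "dirichlet n E (\<lambda>i. of_bool (i = m) * s + c) = s\<^sup>2 * node_degree n E m"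
proof -
  have "dirichlet n E (\<lambda>i. of_bool (i = m) * s + c)
      = (\<Sum>i<n. (of_bool (i = m) * s + c) * (\<Sum>j<n. adj E i j * (of_bool (i = m) * s - of_bool (j = m) * s)))"
    unfolding dirichlet_eq[OF assms(1)] by simp
  also have "\<dots> = (\<Sum>i<n. (of_bool (i = m) * s) * (\<Sum>j<n. adj E i j * (of_bool (i = m) * s - of_bool (j = m) * s)))"
    by (subst (1 2) sum_antisymmetric_pairing) (auto simp: adj_sym[OF assms(1)] algebra_simps)
  also have "\<dots> = s * (\<Sum>j<n. adj E m j * (s - of_bool (j = m) * s))"
  proof -
    have "(\<Sum>i<n. (of_bool (i = m) * s) * (\<Sum>j<n. adj E i j * (of_bool (i = m) * s - of_bool (j = m) * s)))
       = (\<Sum>i<n. if i = m then s * (\<Sum>j<n. adj E m j * (s - of_bool (j = m) * s)) else 0)"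
      by (intro sum.cong) auto
    also have "\<dots> = s * (\<Sum>j<n. adj E m j * (s - of_bool (j = m) * s))"
      using assms(2) by simp
    finally show ?thesis .
  qed
  also have "(\<Sum>j<n. adj E m j * (s - of_bool (j = m) * s)) = (\<Sum>j<n. adj E m j * s)"
    by (intro sum.cong) (auto simp: adj_loop[OF assms(1)])
  finally show ?thesis
    using assms(2) by (simp add: node_degree_eq power2_eq_square sum_distrib_right[symmetric])
qed

section \<open>Algebraic connectivity\<close>

text \<open>
  Vectors of dimension \<open>n\<close> are represented by functions on \<open>nat\<close> that vanish from \<open>n\<close> on, so that
  Tychonoff's theorem for the product topology replaces the Heine-Borel theorem.
\<close>

lemma compact_box_sequences:
  fixes S :: "nat \<Rightarrow> real set"
  assumes "\<And>i. compact (S i)"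
  shows "compact {x. \<forall>i. x i \<in> S i}"
proof -
  have "compactin (product_topology (\<lambda>_. euclidean) UNIV) (Pi\<^sub>E UNIV S)"
    unfolding compactin_PiE using assms by simp
  moreover have "Pi\<^sub>E UNIV S = {x. \<forall>i. x i \<in> S i}" by auto
  ultimately show ?thesis by (simp add: euclidean_product_topology)
qed

lemma compact_centered_box:
  "compact {x :: nat \<Rightarrow> real. (\<forall>i. x i \<in> (if i < n then {- R..R} else {0})) \<and> (\<Sum>i<n. x i) = 0}"
proof -
  have "compact ({x :: nat \<Rightarrow> real. \<forall>i. x i \<in> (if i < n then {- R..R} else {0})} \<inter> {x. (\<Sum>i<n. x i) = 0})"
  proof (rule compact_Int_closed)
    show "compact {x :: nat \<Rightarrow> real. \<forall>i. x i \<in> (if i < n then {- R..R} else {0})}"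
      by (rule compact_box_sequences) simp
    show "closed {x :: nat \<Rightarrow> real. (\<Sum>i<n. x i) = 0}"
      by (intro closed_Collect_eq continuous_intros continuous_on_product_coordinates)
  qed
  then show ?thesis by (simp add: Collect_conj_eq)
qed

lemma nonneg_quadratic_linear_term_zero:
  fixes a b :: real
  assumes "\<And>t. 0 \<le> 2 * t * a + t\<^sup>2 * b"
  shows "a = 0"
proof (rule ccontr)
  assume "a \<noteq> 0"
  show False
  proof (cases "b > 0")
    case True
    have "0 \<le> 2 * (- a / b) * a + (- a / b)\<^sup>2 * b" by (rule assms)
    also have "\<dots> = - (a\<^sup>2 / b)" using True by (simp add: power2_eq_square field_simps)
    finally have "a\<^sup>2 / b \<le> 0" by linarith
    moreover have "a\<^sup>2 / b > 0" using True \<open>a \<noteq> 0\<close> by simp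
    ultimately show False by linarith
  next
    case False
    have "0 \<le> 2 * (- a) * a + (- a)\<^sup>2 * b" by (rule assms)
    moreover have "a\<^sup>2 * b \<le> 0" using False by (simp add: mult_nonneg_nonpos)
    moreover have "a\<^sup>2 > 0" using \<open>a \<noteq> 0\<close> by simp
    ultimately show False by (simp add: power2_eq_square)
  qed
qed

text \<open>
  The minimiser of the Dirichlet form on the unit sphere of the centred vectors is an eigenvector.
  The first variation vanishes in all centred directions, and the residual \<open>w\<close> of the eigenvalue equation
  is itself centred because the rows of the Laplacian sum to 0; so \<open>w\<close> is orthogonal to itself.
\<close>

lemma exists_centered_minimizer:
  assumes "simple_graph n E" "n \<ge> 2"
  obtains u \<mu> where "(\<Sum>i<n. u i) = 0" "(\<Sum>i<n. (u i)\<^sup>2) = 1" "\<mu> \<ge> 0"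
    "\<And>x. (\<Sum>i<n. x i) = 0 \<Longrightarrow> \<mu> * (\<Sum>i<n. (x i)\<^sup>2) \<le> dirichlet n E x"
    "\<And>i. i < n \<Longrightarrow> (\<Sum>j<n. adj E i j * (u i - u j)) = \<mu> * u i"
proof -
  define X where "X = {x :: nat \<Rightarrow> real. (\<forall>i. x i \<in> (if i < n then {- 1..1} else {0})) \<and> (\<Sum>i<n. x i) = 0}"
  define Y where "Y = X \<inter> {x. (\<Sum>i<n. (x i)\<^sup>2) = 1}"
  have "compact Y"
    unfolding Y_def X_def
    by (intro compact_Int_closed compact_centered_box closed_Collect_eq continuous_intros
          continuous_on_product_coordinates)
  moreover have "(\<lambda>i. if i = 0 then 1 / sqrt 2 else if i = 1 then - 1 / sqrt 2 else 0) \<in> Y"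
  proof -
    obtain k where "n = Suc (Suc k)" using assms(2) by (metis add_2_eq_Suc le_Suc_ex)
    then show ?thesis
      unfolding Y_def X_def
      by (auto simp: sum.lessThan_Suc_shift power_divide divide_simps simp del: sum.lessThan_Suc
            intro: order_trans[of _ 0])
  qed
  moreover have "continuous_on Y (dirichlet n E)"
    unfolding dirichlet_def
    by (intro continuous_intros continuous_on_subset[OF continuous_on_product_coordinates]) auto
  ultimately obtain u where u: "u \<in> Y" and min: "\<And>x. x \<in> Y \<Longrightarrow> dirichlet n E u \<le> dirichlet n E x"
    using continuous_attains_inf[of Y "dirichlet n E"] by blast
  define \<mu> where "\<mu> = dirichlet n E u"
  have u0: "(\<Sum>i<n. u i) = 0" and u1: "(\<Sum>i<n. (u i)\<^sup>2) = 1"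
    using u by (auto simp: Y_def X_def)
  have low: "\<mu> * (\<Sum>i<n. (x i)\<^sup>2) \<le> dirichlet n E x" if x0: "(\<Sum>i<n. x i) = 0" for x
  proof (cases "(\<Sum>i<n. (x i)\<^sup>2) = 0")
    case True
    then show ?thesis using dirichlet_nonneg[of n E x] by simp
  next
    case False
    define N where "N = (\<Sum>i<n. (x i)\<^sup>2)"
    have "N \<ge> 0" unfolding N_def by (intro sum_nonneg) simp
    then have N: "N > 0" using False by (simp add: N_def)
    define y where "y = (\<lambda>i. if i < n then x i / sqrt N else 0)"
    have y1: "(\<Sum>i<n. (y i)\<^sup>2) = 1"
      using N by (simp add: y_def power_divide sum_divide_distrib[symmetric] flip: N_def)
    have "- 1 \<le> y i \<and> y i \<le> 1" if "i < n" for i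
    proof -
      have "(y i)\<^sup>2 \<le> (\<Sum>i<n. (y i)\<^sup>2)" using that by (intro member_le_sum) auto
      then have "\<bar>y i\<bar> \<le> 1" unfolding y1 by (simp only: abs_square_le_1)
      then show ?thesis by linarith
    qed
    moreover have "(\<Sum>i<n. y i) = 0"
      using x0 by (simp add: y_def sum_divide_distrib[symmetric])
    moreover have "y i = 0" if "\<not> i < n" for i using that by (simp add: y_def)
    ultimately have "y \<in> Y" using y1 by (simp add: Y_def X_def)
    then have "\<mu> \<le> dirichlet n E y" unfolding \<mu>_def by (rule min)
    also have "dirichlet n E y = (\<Sum>j<n. \<Sum>i<j. adj E i j * (x i - x j)\<^sup>2 / N)"
      unfolding dirichlet_def
    proof (intro sum.cong refl)
      fix i j assume "j \<in> {..<n}" "i \<in> {..<j}"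
      then have "y i - y j = (x i - x j) / sqrt N" by (simp add: y_def diff_divide_distrib)
      then show "adj E i j * (y i - y j)\<^sup>2 = adj E i j * (x i - x j)\<^sup>2 / N"
        using N by (simp add: power_divide)
    qed
    also have "\<dots> = dirichlet n E x / N" by (simp add: dirichlet_def sum_divide_distrib)
    finally show ?thesis using N by (simp add: N_def field_simps)
  qed
  define w where "w = (\<lambda>i. (\<Sum>j<n. adj E i j * (u i - u j)) - \<mu> * u i)"
  have w0: "(\<Sum>i<n. w i) = 0"
    using dirichlet_bilinear[OF assms(1), of "\<lambda>_. 1" u] u0
    by (simp add: w_def sum_subtractf sum_distrib_left[symmetric])
  have orth: "(\<Sum>i<n. v i * w i) = 0" if v0: "(\<Sum>i<n. v i) = 0" for v
  proof (rule nonneg_quadratic_linear_term_zero)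
    fix t :: real
    have "\<mu> * (\<Sum>i<n. (u i + t * v i)\<^sup>2) \<le> dirichlet n E (\<lambda>i. u i + t * v i)"
      by (rule low) (simp add: sum.distrib u0 v0 sum_distrib_left[symmetric])
    moreover have "(\<Sum>i<n. (u i + t * v i)\<^sup>2) = 1 + 2 * t * (\<Sum>i<n. u i * v i) + t\<^sup>2 * (\<Sum>i<n. (v i)\<^sup>2)"
      unfolding u1[symmetric]
      by (simp add: power2_eq_square algebra_simps sum.distrib sum_distrib_left)
    moreover have "(\<Sum>i<n. v i * (\<Sum>j<n. adj E i j * (u i - u j))) = (\<Sum>i<n. v i * w i) + \<mu> * (\<Sum>i<n. u i * v i)"
      by (simp add: w_def right_diff_distrib mult.left_commute mult.commute[of "v _" "u _"]
            sum_subtractf sum_distrib_left)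
    ultimately have "\<mu> * (1 + 2 * t * (\<Sum>i<n. u i * v i) + t\<^sup>2 * (\<Sum>i<n. (v i)\<^sup>2))
        \<le> \<mu> + 2 * t * ((\<Sum>i<n. v i * w i) + \<mu> * (\<Sum>i<n. u i * v i)) + t\<^sup>2 * dirichlet n E v"
      unfolding dirichlet_add[OF assms(1)] \<mu>_def[symmetric] by simp
    then show "0 \<le> 2 * t * (\<Sum>i<n. v i * w i) + t\<^sup>2 * (dirichlet n E v - \<mu> * (\<Sum>i<n. (v i)\<^sup>2))"
      by (simp add: algebra_simps)
  qed
  have "w i = 0" if "i < n" for i
    using orth[OF w0] that by (simp add: sum_nonneg_eq_0_iff)
  then show ?thesis
    using that[of u \<mu>] u0 u1 low dirichlet_nonneg[of n E u] by (simp add: w_def \<mu>_def)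
qed

text \<open>
  Replacing columns \<open>a\<close> and \<open>b\<close> of the identity by the two eigenvectors gives an invertible \<open>P\<close> such
  that columns \<open>a\<close> and \<open>b\<close> of \<open>(x I - A) P\<close> are multiples of \<open>x - \<alpha>\<close> and \<open>x - \<beta>\<close>. Taking determinants
  shows the divisibility. The two eigenvalues may coincide, in which case the root is double.
\<close>

lemma char_poly_dvd_two_eigenvectors:
  fixes A :: "'a::field mat"
  assumes A: "A \<in> carrier_mat n n" and v: "v \<in> carrier_vec n" and w: "w \<in> carrier_vec n"
    and Av: "A *\<^sub>v v = \<alpha> \<cdot>\<^sub>v v" and Aw: "A *\<^sub>v w = \<beta> \<cdot>\<^sub>v w"
    and ab: "a < n" "b < n" "a \<noteq> b" and indep: "v $ a * w $ b \<noteq> v $ b * w $ a"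
  shows "[:- \<alpha>, 1:] * [:- \<beta>, 1:] dvd char_poly A"
proof -
  define P where "P = Matrix.mat n n (\<lambda>(i, j). if j = a then v $ i else if j = b then w $ i else of_bool (i = j))"
  have P: "P \<in> carrier_mat n n" by (simp add: P_def)
  have detP: "det P \<noteq> 0"
  proof
    assume "det P = 0"
    then obtain x where x: "x \<in> carrier_vec n" "x \<noteq> 0\<^sub>v n" "P *\<^sub>v x = 0\<^sub>v n"
      using det_0_iff_vec_prod_zero[OF P] by blast
    have row: "v $ i * x $ a + w $ i * x $ b + (if i = a \<or> i = b then 0 else x $ i) = 0" if "i < n" for i
    proof -
      have "0 = (P *\<^sub>v x) $ i" using x(3) that by simp
      also have "\<dots> = (\<Sum>j<n. P $$ (i, j) * x $ j)"
        using that P x(1) by (simp add: scalar_prod_def lessThan_atLeast0)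
      also have "\<dots> = (\<Sum>j<n. (if j = a then v $ i * x $ a else 0) + (if j = b then w $ i * x $ b else 0)
           + (if j = i then (if i = a \<or> i = b then 0 else x $ i) else 0))"
        using that ab(3) by (intro sum.cong) (auto simp: P_def)
      also have "\<dots> = v $ i * x $ a + w $ i * x $ b + (if i = a \<or> i = b then 0 else x $ i)"
        using ab that by (simp add: sum.distrib)
      finally show ?thesis by simp
    qed
    have ra: "v $ a * x $ a + w $ a * x $ b = 0" and rb: "v $ b * x $ a + w $ b * x $ b = 0"
      using row[of a] row[of b] ab by auto
    have "(v $ a * w $ b - v $ b * w $ a) * x $ a
        = w $ b * (v $ a * x $ a + w $ a * x $ b) - w $ a * (v $ b * x $ a + w $ b * x $ b)"
      by (simp add: algebra_simps)
    then have xa: "x $ a = 0" using indep ra rb by simp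
    have "(v $ a * w $ b - v $ b * w $ a) * x $ b
        = v $ a * (v $ b * x $ a + w $ b * x $ b) - v $ b * (v $ a * x $ a + w $ a * x $ b)"
      by (simp add: algebra_simps)
    then have xb: "x $ b = 0" using indep ra rb by simp
    have "x = 0\<^sub>v n"
    proof (rule eq_vecI)
      fix i assume "i < dim_vec (0\<^sub>v n :: 'a Matrix.vec)"
      then show "x $ i = 0\<^sub>v n $ i"
        using row[of i] xa xb by (cases "i = a \<or> i = b") auto
    qed (use x(1) in auto)
    with x(2) show False ..
  qed
  define B where "B = char_poly_matrix A"
  define Q where "Q = map_mat (\<lambda>c. [:c:]) P"
  have B: "B \<in> carrier_mat n n" and Q: "Q \<in> carrier_mat n n"
    using A P by (auto simp: B_def Q_def)
  define N where "N = Matrix.mat n n (\<lambda>(i, j).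
     if j = a then [:v $ i:] else if j = b then [:w $ i:] else (B * Q) $$ (i, j))"
  define D where "D = Matrix.mat n n (\<lambda>(i, j).
     if i = j then if i = a then [:- \<alpha>, 1:] else if i = b then [:- \<beta>, 1:] else 1 else 0)"
  have N: "N \<in> carrier_mat n n" and D: "D \<in> carrier_mat n n" by (auto simp: N_def D_def)
  have eig: "(\<Sum>k<n. B $$ (i, k) * [:z $ k:]) = [:- \<gamma>, 1:] * [:z $ i:]"
    if "i < n" "z \<in> carrier_vec n" "A *\<^sub>v z = \<gamma> \<cdot>\<^sub>v z" for i z \<gamma>
  proof -
    have "\<gamma> * z $ i = (A *\<^sub>v z) $ i" using that by simp
    also have "\<dots> = (\<Sum>k<n. A $$ (i, k) * z $ k)"
      using that(1,2) A by (simp add: scalar_prod_def lessThan_atLeast0)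
    finally have g: "(\<Sum>k<n. A $$ (i, k) * z $ k) = \<gamma> * z $ i" ..
    have "(\<Sum>k<n. B $$ (i, k) * [:z $ k:])
        = (\<Sum>k<n. (if k = i then [:0, 1:] * [:z $ i:] else 0) - [:A $$ (i, k) * z $ k:])"
      using that A by (intro sum.cong) (auto simp: B_def char_poly_matrix_def)
    also have "\<dots> = [:0, 1:] * [:z $ i:] - (\<Sum>k<n. [:A $$ (i, k) * z $ k:])"
      using that by (simp add: sum_subtractf)
    also have "(\<Sum>k<n. [:A $$ (i, k) * z $ k:]) = [:\<gamma> * z $ i:]"
      unfolding g[symmetric]
      by (rule poly_eqI) (simp add: coeff_sum coeff_pCons split: nat.split)
    finally show ?thesis by simp
  qed
  have "B * Q = N * D"
  proof (rule eq_matI)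
    fix i j assume "i < dim_row (N * D)" "j < dim_col (N * D)"
    then have ij: "i < n" "j < n" using N D by auto
    have "(N * D) $$ (i, j) = (\<Sum>k<n. N $$ (i, k) * D $$ (k, j))"
      using ij N D by (simp add: scalar_prod_def lessThan_atLeast0)
    also have "\<dots> = (\<Sum>k<n. if k = j then N $$ (i, j) * D $$ (j, j) else 0)"
      using ij by (intro sum.cong) (auto simp: D_def)
    also have "\<dots> = N $$ (i, j) * D $$ (j, j)" using ij by simp
    finally have ND: "(N * D) $$ (i, j) = N $$ (i, j) * D $$ (j, j)" .
    have BQ: "(B * Q) $$ (i, j) = (\<Sum>k<n. B $$ (i, k) * [:P $$ (k, j):])"
      using ij B Q P by (simp add: scalar_prod_def lessThan_atLeast0 Q_def)
    consider "j = a" | "j = b" | "j \<noteq> a" "j \<noteq> b" by blast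
    then show "(B * Q) $$ (i, j) = (N * D) $$ (i, j)"
    proof cases
      case 1
      then have "(\<Sum>k<n. B $$ (i, k) * [:P $$ (k, j):]) = (\<Sum>k<n. B $$ (i, k) * [:v $ k:])"
        using ij by (intro sum.cong) (auto simp: P_def)
      then show ?thesis
        unfolding ND BQ using 1 ij eig[OF ij(1) v Av] by (simp add: N_def D_def mult.commute)
    next
      case 2
      then have "(\<Sum>k<n. B $$ (i, k) * [:P $$ (k, j):]) = (\<Sum>k<n. B $$ (i, k) * [:w $ k:])"
        using ij ab by (intro sum.cong) (auto simp: P_def)
      then show ?thesis
        unfolding ND BQ using 2 ij ab eig[OF ij(1) w Aw] by (simp add: N_def D_def mult.commute)
    next
      case 3
      then show ?thesis unfolding ND using ij by (simp add: N_def D_def)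
    qed
  qed (use B Q N D in auto)
  then have "det B * det Q = det N * det D"
    using det_mult[OF B Q] det_mult[OF N D] by simp
  moreover have "det Q = [:det P:]"
  proof -
    interpret comm_ring_hom "\<lambda>c::'a. [:c:]" by unfold_locales (auto simp: one_pCons)
    show ?thesis unfolding Q_def by (rule hom_det)
  qed
  ultimately have eq: "Polynomial.smult (det P) (char_poly A) = det N * det D"
    by (simp add: char_poly_def B_def)
  have "upper_triangular D" using D by (auto simp: upper_triangular_def D_def)
  then have "det D = (\<Prod>i<n. D $$ (i, i))"
    using det_upper_triangular[OF _ D] D by (simp add: prod_list_diag_prod lessThan_atLeast0)
  also have "\<dots> = D $$ (a, a) * (D $$ (b, b) * (\<Prod>i\<in>{..<n} - {a} - {b}. D $$ (i, i)))"
    using ab by (simp add: prod.remove[of "{..<n}" a] prod.remove[of "{..<n} - {a}" b])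
  also have "\<dots> = ([:- \<alpha>, 1:] * [:- \<beta>, 1:]) * (\<Prod>i\<in>{..<n} - {a} - {b}. D $$ (i, i))"
  proof -
    have "D $$ (a, a) = [:- \<alpha>, 1:]" "D $$ (b, b) = [:- \<beta>, 1:]"
      using ab by (simp_all add: D_def)
    then show ?thesis by (simp only: mult.assoc)
  qed
  finally have "det D = ([:- \<alpha>, 1:] * [:- \<beta>, 1:]) * (\<Prod>i\<in>{..<n} - {a} - {b}. D $$ (i, i))" .
  then have "[:- \<alpha>, 1:] * [:- \<beta>, 1:] dvd det D" by (rule dvdI)
  then have "[:- \<alpha>, 1:] * [:- \<beta>, 1:] dvd Polynomial.smult (det P) (char_poly A)"
    unfolding eq by (rule dvd_mult)
  then show ?thesis using detP by (rule dvd_smult_cancel)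
qed

lemma sorted_list_of_multiset_second_le:
  fixes x y :: "'a::linorder"
  assumes "{#x, y#} \<subseteq># M" "x \<le> z" "y \<le> z"
  shows "sorted_list_of_multiset M ! 1 \<le> z"
proof (rule ccontr)
  assume neg: "\<not> sorted_list_of_multiset M ! 1 \<le> z"
  define xs where "xs = sorted_list_of_multiset M"
  have "{#x, y#} \<subseteq># mset xs" using assms(1) by (simp add: xs_def)
  then have "filter_mset (\<lambda>t. t \<le> z) {#x, y#} \<subseteq># filter_mset (\<lambda>t. t \<le> z) (mset xs)"
    by (rule multiset_filter_mono)
  then have "size {#x, y#} \<le> size (filter_mset (\<lambda>t. t \<le> z) (mset xs))"
    using assms(2,3) size_mset_mono by fastforce
  then have len: "2 \<le> length (filter (\<lambda>t. t \<le> z) xs)" by (simp flip: mset_filter)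
  then obtain p q r where xs: "xs = p # q # r"
    by (cases xs; cases "tl xs") (auto split: if_splits)
  have "sorted xs" by (simp add: xs_def)
  then have "filter (\<lambda>t. t \<le> z) (q # r) = []"
    using neg xs by (auto simp: filter_empty_conv xs_def[symmetric])
  then have "length (filter (\<lambda>t. t \<le> z) xs) \<le> 1" by (simp add: xs)
  with len show False by simp
qed

lemma second_smallest_eigenvalue_le:
  assumes A: "A \<in> carrier_mat n n" and v: "v \<in> carrier_vec n" and w: "w \<in> carrier_vec n"
    and Av: "A *\<^sub>v v = \<alpha> \<cdot>\<^sub>v v" and Aw: "A *\<^sub>v w = \<beta> \<cdot>\<^sub>v w"
    and ab: "a < n" "b < n" "a \<noteq> b" and indep: "v $ a * w $ b \<noteq> v $ b * w $ a"
  shows "second_smallest_eigenvalue A \<le> max \<alpha> \<beta>"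
proof -
  obtain q where q: "char_poly A = [:- \<alpha>, 1:] * [:- \<beta>, 1:] * q"
    using char_poly_dvd_two_eigenvectors[OF assms] by (elim dvdE)
  have "char_poly A \<noteq> 0" using degree_monic_char_poly[OF A] by auto
  then have "q \<noteq> 0" unfolding q by auto
  have "proots (char_poly A) = proots [:- \<alpha>, 1:] + proots [:- \<beta>, 1:] + proots q"
    unfolding q using \<open>q \<noteq> 0\<close>
    by (simp add: proots_mult del: mult_pCons_left mult_pCons_right)
  also have "\<dots> = {#\<alpha>, \<beta>#} + proots q" by simp
  finally have "{#\<alpha>, \<beta>#} \<subseteq># proots (char_poly A)" by simp
  then show ?thesis
    unfolding second_smallest_eigenvalue_def by (rule sorted_list_of_multiset_second_le) simp_all
qed

lemma laplacian_carrier: "laplacian n E \<in> carrier_mat n n"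
  unfolding laplacian_def adj_mat_def by (intro minus_carrier_mat mat_carrier)

lemma laplacian_mult_vec:
  assumes "i < n"
  shows "(laplacian n E *\<^sub>v vec n x) $ i = (\<Sum>j<n. adj E i j * (x i - x j))"
proof -
  have "(laplacian n E *\<^sub>v vec n x) $ i = (\<Sum>j<n. laplacian n E $$ (i, j) * x j)"
    using assms laplacian_carrier[of n E] by (simp add: scalar_prod_def lessThan_atLeast0)
  also have "\<dots> = (\<Sum>j<n. (if j = i then node_degree n E i * x i else 0) - adj E i j * x j)"
    using assms by (intro sum.cong) (auto simp: laplacian_def adj_mat_def adj_def algebra_simps)
  also have "\<dots> = node_degree n E i * x i - (\<Sum>j<n. adj E i j * x j)"
    using assms by (simp add: sum_subtractf)
  also have "\<dots> = (\<Sum>j<n. adj E i j * (x i - x j))"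
    using assms by (simp add: node_degree_eq right_diff_distrib sum_subtractf sum_distrib_right)
  finally show ?thesis .
qed

text \<open>
  The variational lower bound that characterises \<open>\<lambda>\<^sub>2\<close>, with the constant vector as the eigenvector
  of the eigenvalue 0.
\<close>

lemma second_smallest_eigenvalue_le_dirichlet:
  assumes "simple_graph n E" "n \<ge> 2" "(\<Sum>i<n. x i) = 0"
  shows "second_smallest_eigenvalue (laplacian n E) * (\<Sum>i<n. (x i)\<^sup>2) \<le> dirichlet n E x"
proof -
  obtain u \<mu> where u0: "(\<Sum>i<n. u i) = 0" and u1: "(\<Sum>i<n. (u i)\<^sup>2) = 1" and \<mu>: "\<mu> \<ge> 0"
    and low: "\<And>x. (\<Sum>i<n. x i) = 0 \<Longrightarrow> \<mu> * (\<Sum>i<n. (x i)\<^sup>2) \<le> dirichlet n E x"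
    and eig: "\<And>i. i < n \<Longrightarrow> (\<Sum>j<n. adj E i j * (u i - u j)) = \<mu> * u i"
    by (rule exists_centered_minimizer[OF assms(1,2)]) blast
  have "\<exists>b<n. u b \<noteq> u 0"
  proof (rule ccontr)
    assume "\<not> (\<exists>b<n. u b \<noteq> u 0)"
    then have c: "u b = u 0" if "b < n" for b using that by blast
    have "(\<Sum>i<n. u i) = (\<Sum>i<n. u 0)" by (intro sum.cong refl c) simp
    then have "u 0 = 0" using u0 assms(2) by simp
    then have "u i = 0" if "i < n" for i using c[OF that] by simp
    then have "(\<Sum>i<n. (u i)\<^sup>2) = 0" by simp
    with u1 show False by simp
  qed
  then obtain b where b: "b < n" "u b \<noteq> u 0" by blast
  have "second_smallest_eigenvalue (laplacian n E) \<le> max 0 \<mu>"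
  proof (rule second_smallest_eigenvalue_le[OF laplacian_carrier])
    show "laplacian n E *\<^sub>v vec n (\<lambda>_. 1) = 0 \<cdot>\<^sub>v vec n (\<lambda>_. 1)"
      using laplacian_carrier[of n E]
      by (intro eq_vecI) (simp_all add: laplacian_mult_vec del: index_mult_mat_vec)
    show "laplacian n E *\<^sub>v vec n u = \<mu> \<cdot>\<^sub>v vec n u"
      using laplacian_carrier[of n E]
      by (intro eq_vecI) (simp_all add: laplacian_mult_vec eig del: index_mult_mat_vec)
    show "0 < n" "b < n" using b by auto
    show "0 \<noteq> b" using b by metis
    show "vec n (\<lambda>_. 1) $ 0 * vec n u $ b \<noteq> vec n (\<lambda>_. 1) $ b * vec n u $ 0"
      using b assms(2) by simp
  qed simp_all
  then have "second_smallest_eigenvalue (laplacian n E) \<le> \<mu>" using \<mu> by simp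
  then have "second_smallest_eigenvalue (laplacian n E) * (\<Sum>i<n. (x i)\<^sup>2) \<le> \<mu> * (\<Sum>i<n. (x i)\<^sup>2)"
    by (intro mult_right_mono sum_nonneg) simp_all
  also have "\<dots> \<le> dirichlet n E x" by (rule low[OF assms(3)])
  finally show ?thesis .
qed

text \<open>
  Testing the variational bound with a centred point mass, whose squared norm is \<open>1 - 1 / n \<ge> 1 / 2\<close>.
\<close>

lemma second_smallest_eigenvalue_le_degree:
  assumes "simple_graph n E" "n \<ge> 2" "m < n" "second_smallest_eigenvalue (laplacian n E) \<ge> 0"
  shows "second_smallest_eigenvalue (laplacian n E) \<le> 2 * node_degree n E m"
proof -
  define x where "x = (\<lambda>i. of_bool (i = m) * 1 + - (1 / real n))"
  have "(\<Sum>i<n. x i) = (\<Sum>i<n. if i = m then 1 else 0) - (\<Sum>i<n. 1 / real n)"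
    by (simp add: x_def sum_subtractf[symmetric] of_bool_def del: sum.delta sum_constant)
  then have x0: "(\<Sum>i<n. x i) = 0" using assms by simp
  have "1 / 2 \<le> (\<Sum>i<n. (x i)\<^sup>2)"
  proof -
    have "(\<Sum>i<n. (x i)\<^sup>2) = (\<Sum>i<n. (if i = m then 1 - 2 / real n else 0) + (1 / real n)\<^sup>2)"
      by (intro sum.cong) (auto simp: x_def power2_eq_square algebra_simps)
    also have "\<dots> = 1 - 1 / real n"
      using assms by (simp add: sum.distrib power2_eq_square)
    finally have "(\<Sum>i<n. (x i)\<^sup>2) = 1 - 1 / real n" .
    moreover have "1 / real n \<le> 1 / 2" using assms(2) by (simp add: field_simps)
    ultimately show ?thesis by linarith
  qed
  then have "second_smallest_eigenvalue (laplacian n E) * (1 / 2)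
      \<le> second_smallest_eigenvalue (laplacian n E) * (\<Sum>i<n. (x i)\<^sup>2)"
    using assms(4) by (intro mult_left_mono)
  also have "\<dots> \<le> dirichlet n E x"
    by (rule second_smallest_eigenvalue_le_dirichlet[OF assms(1,2) x0])
  also have "\<dots> = node_degree n E m"
    using dirichlet_point[OF assms(1,3), of 1 "- (1 / real n)"] by (simp add: x_def)
  finally show ?thesis by simp
qed

section \<open>The logistic function\<close>

lemma logistic_minus: "logistic (- t) = 1 - logistic t"
proof -
  define e where "e = exp t"
  have e: "e > 0" by (simp add: e_def)
  have "1 / (1 + e) = 1 - 1 / (1 + 1 / e)" using e by (simp add: divide_simps)
  then show ?thesis by (simp add: logistic_def exp_minus inverse_eq_divide e_def)
qed

lemma logistic_pos: "0 < logistic t"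
  unfolding logistic_def by (intro divide_pos_pos add_pos_pos) simp_all

lemma logistic_less_1: "logistic t < 1"
  using logistic_pos[of "- t"] by (simp add: logistic_minus)

lemma logistic_deriv [derivative_intros]:
  assumes "(f has_real_derivative f') (at t within A)"
  shows "((\<lambda>t. logistic (f t)) has_real_derivative logistic (f t) * (1 - logistic (f t)) * f') (at t within A)"
proof -
  define e where "e = 1 + exp (- f t)"
  have e: "e \<noteq> 0" using exp_gt_zero[of "- f t"] unfolding e_def by linarith
  have "((\<lambda>t. 1 + exp (- f t)) has_real_derivative - (exp (- f t) * f')) (at t within A)"
    by (auto intro!: derivative_eq_intros assms)
  then have "((\<lambda>t. inverse (1 + exp (- f t))) has_real_derivative
      - (inverse e * - (exp (- f t) * f') * inverse e)) (at t within A)"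
    using DERIV_inverse' e unfolding e_def by blast
  moreover have "exp (- f t) = e - 1" by (simp add: e_def)
  moreover have "- (inverse e * - ((e - 1) * f') * inverse e) = inverse e * (1 - inverse e) * f'"
    using e by (simp add: field_simps)
  ultimately have "((\<lambda>t. inverse (1 + exp (- f t))) has_real_derivative
      inverse e * (1 - inverse e) * f') (at t within A)" by (simp only:)
  then show ?thesis by (simp only: logistic_def inverse_eq_divide e_def)
qed

lemma logistic_mono: "s \<le> t \<Longrightarrow> logistic s \<le> logistic t"
  unfolding logistic_def by (intro divide_left_mono mult_pos_pos add_pos_pos) auto

lemma logistic_variance_lower:
  assumes "\<bar>t\<bar> \<le> B"
  shows "exp (- B) / 4 \<le> logistic t * (1 - logistic t)"
proof -
  have *: "exp (- s) / 4 \<le> logistic s * logistic (- s)" if "s \<ge> 0" for s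
  proof -
    have "(1 + exp (- s)) * (1 + exp s) \<le> 2 * (2 * exp s)"
      using that by (intro mult_mono) auto
    then have "1 / (2 * (2 * exp s)) \<le> 1 / ((1 + exp (- s)) * (1 + exp s))"
      by (intro divide_left_mono mult_pos_pos add_pos_pos) auto
    then show ?thesis by (simp add: logistic_def exp_minus field_simps)
  qed
  have "exp (- B) / 4 \<le> exp (- \<bar>t\<bar>) / 4" using assms by simp
  also have "\<dots> \<le> logistic t * logistic (- t)"
    using *[of t] *[of "- t"] by (cases "t \<ge> 0") (simp_all add: mult.commute)
  finally show ?thesis by (simp add: logistic_minus)
qed

text \<open>
  For a small increment this is the mean value theorem; the derivative loses a factor \<open>exp (- 1) \<ge> 1 / 3\<close>
  over a step of length 1. Beyond that, monotonicity preserves the gain of the first unit step. The bound thus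
  holds for increments of any size, which is what allows errors without an a priori bound.
\<close>

lemma logistic_increment_lower:
  assumes "\<bar>a\<bar> \<le> B" "d \<ge> 0"
  shows "exp (- B) / 12 * min d 1 \<le> logistic (a + d) - logistic a"
proof (cases "d = 0")
  case False
  define e where "e = min d 1"
  have e: "0 < e" "e \<le> 1" "e \<le> d" using False assms(2) by (auto simp: e_def)
  obtain z where z: "a < z" "z < a + e"
    "logistic (a + e) - logistic a = (a + e - a) * (logistic z * (1 - logistic z) * 1)"
    using MVT2[of a "a + e" logistic "\<lambda>z. logistic z * (1 - logistic z) * 1"]
      logistic_deriv[OF DERIV_ident] e(1) by fastforce
  have "exp (- B) / 12 \<le> exp (- (B + 1)) / 4"
  proof -
    have "exp (- B) = exp (- (B + 1)) * exp 1" by (simp flip: exp_add)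
    also have "\<dots> \<le> exp (- (B + 1)) * 3" using exp_le by (intro mult_left_mono) auto
    finally show ?thesis by simp
  qed
  also have "\<dots> \<le> logistic z * (1 - logistic z)"
    using z e assms(1) by (intro logistic_variance_lower) auto
  finally have "exp (- B) / 12 * e \<le> logistic z * (1 - logistic z) * e"
    using e by (intro mult_right_mono) auto
  also have "\<dots> = logistic (a + e) - logistic a" using z(3) by simp
  also have "\<dots> \<le> logistic (a + d) - logistic a" using logistic_mono[of "a + e" "a + d"] e by simp
  finally show ?thesis by (simp add: e_def)
qed simp

section \<open>Error bounds from the balance equations\<close>

lemma sum_mult_le_sqrt:
  fixes f g :: "'a \<Rightarrow> real"
  shows "(\<Sum>i\<in>I. f i * g i) \<le> sqrt (\<Sum>i\<in>I. (f i)\<^sup>2) * sqrt (\<Sum>i\<in>I. (g i)\<^sup>2)"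
  unfolding real_sqrt_mult[symmetric]
  by (rule real_le_rsqrt) (rule Cauchy_Schwarz_ineq_sum)

text \<open>
  Pair the balance equations with \<open>\<delta>\<close>. An increment \<open>d\<close> with \<open>\<bar>d\<bar> \<le> T\<close> satisfies
  \<open>\<bar>d\<bar> min \<bar>d\<bar> 1 \<ge> d\<^sup>2 / T\<close>, so the flow has at least the energy \<open>\<beta> / T\<close> times the Dirichlet form of \<open>\<delta>\<close>,
  while the regularisation only adds a nonnegative term.
\<close>

lemma balanced_l2_bound:
  fixes D :: "nat \<Rightarrow> nat \<Rightarrow> real" and \<delta> g :: "nat \<Rightarrow> real"
  assumes graph: "simple_graph n E" and pos: "\<beta> > 0" "lam > 0" "\<rho> \<ge> 0"
    and rayleigh: "lam * (\<Sum>i<n. (\<delta> i)\<^sup>2) \<le> dirichlet n E \<delta>"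
    and antisym: "\<And>i j. i < n \<Longrightarrow> j < n \<Longrightarrow> D i j = - D j i"
    and lower: "\<And>i j. i < n \<Longrightarrow> j < n \<Longrightarrow> (i, j) \<in> E \<Longrightarrow> \<delta> j \<le> \<delta> i \<Longrightarrow> \<beta> * min (\<delta> i - \<delta> j) 1 \<le> D i j"
    and balance: "\<And>i. i < n \<Longrightarrow> (\<Sum>j<n. adj E i j * D i j) + \<rho> * \<delta> i = g i"
    and T: "T \<ge> 1" "\<And>i j. i < n \<Longrightarrow> j < n \<Longrightarrow> \<bar>\<delta> i - \<delta> j\<bar> \<le> T"
  shows "sqrt (\<Sum>i<n. (\<delta> i)\<^sup>2) \<le> T * sqrt (\<Sum>i<n. (g i)\<^sup>2) / (\<beta> * lam)"
proof -
  define N where "N = sqrt (\<Sum>i<n. (\<delta> i)\<^sup>2)"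
  have N: "N \<ge> 0" "N\<^sup>2 = (\<Sum>i<n. (\<delta> i)\<^sup>2)" by (simp_all add: N_def sum_nonneg)
  have one: "\<beta> / T * d\<^sup>2 \<le> c * d" if "0 \<le> d" "d \<le> T" "\<beta> * min d 1 \<le> c" for c d
  proof -
    have "d \<le> T * min d 1" using that(1,2) T(1) by (auto simp: min_def mult_le_cancel_right1)
    then have "d / T \<le> min d 1" using T(1) by (simp only: pos_divide_le_eq mult.commute)
    then have "\<beta> * (d / T) \<le> \<beta> * min d 1" using pos by (intro mult_left_mono) auto
    then have "\<beta> * (d / T) * d \<le> c * d" using that by (intro mult_right_mono) auto
    then show ?thesis by (simp add: power2_eq_square)
  qed
  have edge: "\<beta> / T * (adj E i j * (\<delta> i - \<delta> j)\<^sup>2) \<le> adj E i j * D i j * (\<delta> i - \<delta> j)" if "i < n" "j < n" for i j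
  proof (cases "(i, j) \<in> E")
    case True
    then have ji: "(j, i) \<in> E" using graph by (auto simp: simple_graph_def sym_def)
    have "\<beta> / T * (\<delta> i - \<delta> j)\<^sup>2 \<le> D i j * (\<delta> i - \<delta> j)"
    proof (cases "\<delta> j \<le> \<delta> i")
      case True
      show ?thesis
        by (rule one) (use True \<open>(i, j) \<in> E\<close> that lower T(2)[OF that] in auto)
    next
      case False
      have "\<beta> / T * (\<delta> j - \<delta> i)\<^sup>2 \<le> D j i * (\<delta> j - \<delta> i)"
        by (rule one) (use False ji that lower[OF that(2,1) ji] T(2)[OF that] in auto)
      then show ?thesis using antisym[OF that] by (simp add: power2_commute algebra_simps)
    qed
    then show ?thesis using True by (simp add: adj_def)
  qed (simp add: adj_def)
  have "\<beta> / T * (lam * N\<^sup>2) \<le> \<beta> / T * dirichlet n E \<delta>"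
    using rayleigh pos T(1) unfolding N by (intro mult_left_mono) auto
  also have "\<dots> = (\<Sum>j<n. \<Sum>i<j. \<beta> / T * (adj E i j * (\<delta> i - \<delta> j)\<^sup>2))"
    by (simp add: dirichlet_def sum_distrib_left)
  also have "\<dots> \<le> (\<Sum>j<n. \<Sum>i<j. adj E i j * D i j * (\<delta> i - \<delta> j))"
    by (intro sum_mono edge) auto
  also have "\<dots> = (\<Sum>i<n. \<delta> i * (\<Sum>j<n. adj E i j * D i j))"
  proof (rule sum_antisymmetric_pairing[symmetric])
    fix i j assume "i < n" "j < n"
    then show "adj E i j * D i j = - (adj E j i * D j i)"
      by (simp only: antisym[of i j] adj_sym[OF graph, of i j] mult_minus_right)
  qed
  also have "\<dots> = (\<Sum>i<n. g i * \<delta> i - \<rho> * (\<delta> i)\<^sup>2)"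
  proof (intro sum.cong refl)
    fix i assume "i \<in> {..<n}"
    then have "(\<Sum>j<n. adj E i j * D i j) = g i - \<rho> * \<delta> i" using balance[of i] by simp
    show "\<delta> i * (\<Sum>j<n. adj E i j * D i j) = g i * \<delta> i - \<rho> * (\<delta> i)\<^sup>2"
      unfolding \<open>(\<Sum>j<n. adj E i j * D i j) = g i - \<rho> * \<delta> i\<close>
      by (simp add: power2_eq_square algebra_simps)
  qed
  also have "\<dots> \<le> (\<Sum>i<n. g i * \<delta> i)" using pos by (intro sum_mono) simp
  also have "\<dots> \<le> sqrt (\<Sum>i<n. (g i)\<^sup>2) * N" unfolding N_def by (rule sum_mult_le_sqrt)
  finally have main: "\<beta> / T * lam * N * N \<le> sqrt (\<Sum>i<n. (g i)\<^sup>2) * N" by (simp add: power2_eq_square mult.assoc)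
  have "\<beta> / T * lam * N \<le> sqrt (\<Sum>i<n. (g i)\<^sup>2)"
  proof (cases "N = 0")
    case False
    then show ?thesis using N(1) by (intro mult_right_le_imp_le[OF main]) simp
  qed (simp add: sum_nonneg)
  then show ?thesis using pos T(1) by (simp add: N_def[symmetric] field_simps)
qed

text \<open>
  The deterministic core. Let \<open>M\<close> be the largest error, attained at \<open>m\<close>, and \<open>s\<close> its sign there. All terms of
  the flow at \<open>m\<close> have sign \<open>s\<close>, and so does the regularisation, hence each part is bounded by \<open>\<bar>g m\<bar>\<close>
  (fact \<open>row\<close>). For \<open>M \<ge> 1\<close> this contradicts the Euclidean bound with \<open>T = 2 M\<close>, as most neighbours of \<open>m\<close>
  have errors below \<open>M / 2\<close>; for \<open>M < 1\<close> it is the uniform bound.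
\<close>

lemma balanced_error_bounds:
  fixes D :: "nat \<Rightarrow> nat \<Rightarrow> real" and \<delta> g :: "nat \<Rightarrow> real"
  assumes graph: "simple_graph n E" and n: "n > 0" and pos: "\<beta> > 0" "lam > 0" "\<rho> \<ge> 0"
    and rayleigh: "lam * (\<Sum>i<n. (\<delta> i)\<^sup>2) \<le> dirichlet n E \<delta>"
    and antisym: "\<And>i j. i < n \<Longrightarrow> j < n \<Longrightarrow> D i j = - D j i"
    and lower: "\<And>i j. i < n \<Longrightarrow> j < n \<Longrightarrow> (i, j) \<in> E \<Longrightarrow> \<delta> j \<le> \<delta> i \<Longrightarrow> \<beta> * min (\<delta> i - \<delta> j) 1 \<le> D i j"
    and balance: "\<And>i. i < n \<Longrightarrow> (\<Sum>j<n. adj E i j * D i j) + \<rho> * \<delta> i = g i"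
    and degree: "\<And>i. i < n \<Longrightarrow> 0 < node_degree n E i"
    and small_l2: "\<And>i. i < n \<Longrightarrow> sqrt (\<Sum>i<n. (g i)\<^sup>2) / (\<beta> * lam) \<le> sqrt (node_degree n E i) / 6"
    and small: "\<And>i. i < n \<Longrightarrow> \<bar>g i\<bar> < \<beta> * node_degree n E i / 4"
  shows "sqrt (\<Sum>i<n. (\<delta> i)\<^sup>2) \<le> 2 * sqrt (\<Sum>i<n. (g i)\<^sup>2) / (\<beta> * lam)"
    and "\<exists>m<n. \<forall>i<n. \<bar>\<delta> i\<bar> \<le> sqrt (\<Sum>i<n. (\<delta> i)\<^sup>2) / sqrt (node_degree n E m)
           + 2 * \<bar>g m\<bar> / (\<beta> * node_degree n E m)"
proof -
  define N where "N = sqrt (\<Sum>i<n. (\<delta> i)\<^sup>2)"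
  define S where "S = sqrt (\<Sum>i<n. (g i)\<^sup>2) / (\<beta> * lam)"
  have N: "N \<ge> 0" "N\<^sup>2 = (\<Sum>i<n. (\<delta> i)\<^sup>2)" by (simp_all add: N_def sum_nonneg)
  have S: "S \<ge> 0" using pos by (simp add: S_def sum_nonneg)
  obtain m where m: "m < n" and max: "\<And>i. i < n \<Longrightarrow> \<bar>\<delta> i\<bar> \<le> \<bar>\<delta> m\<bar>"
  proof -
    have "Max ((\<lambda>i. \<bar>\<delta> i\<bar>) ` {..<n}) \<in> (\<lambda>i. \<bar>\<delta> i\<bar>) ` {..<n}"
      using n by (intro Max_in) auto
    then obtain m where "m < n" "Max ((\<lambda>i. \<bar>\<delta> i\<bar>) ` {..<n}) = \<bar>\<delta> m\<bar>" by auto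
    then show ?thesis using that[of m] by (metis Max_ge finite_imageI finite_lessThan image_eqI lessThan_iff)
  qed
  define M where "M = \<bar>\<delta> m\<bar>"
  define d where "d = node_degree n E m"
  have d: "d > 0" using degree[OF m] by (simp add: d_def)
  have d_sum: "d = (\<Sum>j<n. adj E m j)" using m by (simp add: d_def node_degree_eq)
  have diff: "\<bar>\<delta> i - \<delta> j\<bar> \<le> 2 * M" if "i < n" "j < n" for i j
    using max[OF that(1)] max[OF that(2)] by (simp add: M_def)
  define s :: real where "s = (if \<delta> m \<ge> 0 then 1 else - 1)"
  have s: "\<bar>s\<bar> = 1" "s * \<delta> m = M" by (auto simp: s_def M_def)
  have sle: "s * \<delta> j \<le> \<bar>\<delta> j\<bar>" for j using s(1) by (auto simp: s_def)
  have row: "\<beta> * (\<Sum>j<n. adj E m j * min (M - s * \<delta> j) 1) \<le> \<bar>g m\<bar>"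
  proof -
    have "adj E m j * (\<beta> * min (M - s * \<delta> j) 1) \<le> adj E m j * (s * D m j)" if j: "j < n" for j
    proof (cases "(m, j) \<in> E")
      case True
      then have jm: "(j, m) \<in> E" using graph by (auto simp: simple_graph_def sym_def)
      have le: "\<bar>\<delta> j\<bar> \<le> M" using max[OF j] by (simp add: M_def)
      have "\<beta> * min (M - s * \<delta> j) 1 \<le> s * D m j"
      proof (cases "\<delta> m \<ge> 0")
        case True
        then show ?thesis
          using lower[OF m j \<open>(m, j) \<in> E\<close>] le s(2) by (simp add: s_def M_def)
      next
        case False
        then show ?thesis
          using lower[OF j m jm] le s(2) antisym[OF m j] by (simp add: s_def M_def)
      qed
      then show ?thesis by (intro mult_left_mono) simp_all
    qed (simp add: adj_def)
    then have "(\<Sum>j<n. adj E m j * (\<beta> * min (M - s * \<delta> j) 1)) \<le> (\<Sum>j<n. adj E m j * (s * D m j))"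
      by (intro sum_mono) auto
    also have "\<dots> = s * (g m - \<rho> * \<delta> m)"
      by (simp add: balance[OF m, symmetric] sum_distrib_left mult.left_commute)
    also have "\<dots> = s * g m - \<rho> * M" by (simp add: algebra_simps flip: s(2))
    also have "\<dots> \<le> \<bar>g m\<bar>"
    proof -
      have "s * g m \<le> \<bar>g m\<bar>" by (auto simp: s_def)
      moreover have "0 \<le> \<rho> * M" using pos by (simp add: M_def)
      ultimately show ?thesis by linarith
    qed
    finally show ?thesis by (simp add: sum_distrib_left mult.left_commute)
  qed
  have "M < 1"
  proof (rule ccontr)
    assume "\<not> M < 1"
    then have M: "M \<ge> 1" by simp
    have "N \<le> 2 * M * sqrt (\<Sum>i<n. (g i)\<^sup>2) / (\<beta> * lam)"
      unfolding N_def
      by (rule balanced_l2_bound[OF graph pos rayleigh antisym lower balance]) (use M diff in auto)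
    then have "N \<le> 2 * M * S" by (simp add: S_def)
    also have "\<dots> \<le> 2 * M * (sqrt d / 6)"
      using small_l2[OF m] M by (intro mult_left_mono) (auto simp: S_def d_def)
    finally have "N \<le> M * sqrt d / 3" by simp
    then have "N\<^sup>2 \<le> (M * sqrt d / 3)\<^sup>2" using N(1) by (rule power_mono)
    \<comment> \<open>the constant 6 in the smallness hypothesis makes \<open>2 N\<^sup>2 / M\<^sup>2 \<le> 2 d / 9 < d / 4\<close>\<close>
    then have N2: "N\<^sup>2 \<le> M\<^sup>2 * d / 9" using d by (simp add: power_mult_distrib power_divide)
    \<comment> \<open>Instead of counting the neighbours with an error above \<open>M / 2\<close>, subtract a multiple of \<open>(\<delta> j)\<^sup>2\<close>
      that makes the bound trivial for them.\<close>
    have "1 / 2 - 2 * (\<delta> j)\<^sup>2 / M\<^sup>2 \<le> min (M - s * \<delta> j) 1" if "j < n" for j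
    proof (cases "s * \<delta> j \<le> M / 2")
      case True
      have "0 \<le> 2 * (\<delta> j)\<^sup>2 / M\<^sup>2" by simp
      then show ?thesis using True M by (intro min.boundedI) linarith+
    next
      case False
      then have "M / 2 \<le> \<bar>\<delta> j\<bar>" using sle[of j] by linarith
      then have "(M / 2)\<^sup>2 \<le> (\<delta> j)\<^sup>2" using M by (simp add: abs_le_square_iff[symmetric])
      then have "1 / 2 \<le> 2 * (\<delta> j)\<^sup>2 / M\<^sup>2" using M by (simp add: power_divide field_simps)
      moreover have "s * \<delta> j \<le> M" using sle[of j] max[OF that] by (simp add: M_def)
      ultimately show ?thesis by (intro min.boundedI) linarith+
    qed
    then have "(\<Sum>j<n. adj E m j * (1 / 2 - 2 * (\<delta> j)\<^sup>2 / M\<^sup>2)) \<le> (\<Sum>j<n. adj E m j * min (M - s * \<delta> j) 1)"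
      by (intro sum_mono mult_left_mono) auto
    moreover have "(\<Sum>j<n. adj E m j * (1 / 2 - 2 * (\<delta> j)\<^sup>2 / M\<^sup>2))
        = d / 2 - 2 / M\<^sup>2 * (\<Sum>j<n. adj E m j * (\<delta> j)\<^sup>2)"
      by (simp add: right_diff_distrib sum_subtractf d_sum sum_divide_distrib sum_distrib_left mult_ac)
    moreover have "2 / M\<^sup>2 * (\<Sum>j<n. adj E m j * (\<delta> j)\<^sup>2) \<le> 2 / M\<^sup>2 * N\<^sup>2"
      unfolding N by (intro mult_left_mono sum_mono mult_left_le_one_le) (auto simp: adj_le_1)
    moreover have "2 / M\<^sup>2 * N\<^sup>2 \<le> 2 / M\<^sup>2 * (M\<^sup>2 * d / 9)" using N2 by (intro mult_left_mono) auto
    moreover have "2 / M\<^sup>2 * (M\<^sup>2 * d / 9) = 2 * d / 9" using M by simp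
    ultimately have "d / 4 \<le> (\<Sum>j<n. adj E m j * min (M - s * \<delta> j) 1)" using d by linarith
    then have "\<beta> * (d / 4) \<le> \<bar>g m\<bar>"
      using row pos(1) by (intro order_trans[OF mult_left_mono row]) auto
    then show False using small[OF m] by (simp add: d_def)
  qed
  have diff2: "\<bar>\<delta> i - \<delta> j\<bar> \<le> 2" if "i < n" "j < n" for i j
    using diff[OF that] \<open>M < 1\<close> by linarith
  show l2: "sqrt (\<Sum>i<n. (\<delta> i)\<^sup>2) \<le> 2 * sqrt (\<Sum>i<n. (g i)\<^sup>2) / (\<beta> * lam)"
    by (rule balanced_l2_bound[OF graph pos rayleigh antisym lower balance])
       (use diff2 in auto)
  have "(M - s * \<delta> j) / 2 \<le> min (M - s * \<delta> j) 1" if "j < n" for j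
    using \<open>M < 1\<close> max[OF that] sle[of j] abs_ge_minus_self[of "\<delta> j"] by (auto simp: M_def s_def)
  then have "(\<Sum>j<n. adj E m j * ((M - s * \<delta> j) / 2)) \<le> (\<Sum>j<n. adj E m j * min (M - s * \<delta> j) 1)"
    by (intro sum_mono mult_left_mono) auto
  then have half: "\<beta> * (\<Sum>j<n. adj E m j * ((M - s * \<delta> j) / 2)) \<le> \<bar>g m\<bar>"
    using pos(1) by (intro order_trans[OF mult_left_mono row]) auto
  have split: "(\<Sum>j<n. adj E m j * ((M - s * \<delta> j) / 2)) = (d * M - (\<Sum>j<n. adj E m j * (s * \<delta> j))) / 2"
    by (simp add: d_sum right_diff_distrib diff_divide_distrib sum_subtractf sum_divide_distrib sum_distrib_right)
  have neighbours: "(\<Sum>j<n. adj E m j * (s * \<delta> j)) \<le> sqrt d * N"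
  proof -
    have "(\<Sum>j<n. adj E m j * (s * \<delta> j)) \<le> sqrt (\<Sum>j<n. (adj E m j)\<^sup>2) * sqrt (\<Sum>j<n. (s * \<delta> j)\<^sup>2)"
      by (rule sum_mult_le_sqrt)
    moreover have "(s * \<delta> j)\<^sup>2 = (\<delta> j)\<^sup>2" for j by (simp add: s_def)
    ultimately show ?thesis by (simp add: d_sum N_def)
  qed
  have "\<beta> * ((d * M - sqrt d * N) / 2) \<le> \<bar>g m\<bar>"
  proof (rule order_trans[OF mult_left_mono half])
    show "(d * M - sqrt d * N) / 2 \<le> (\<Sum>j<n. adj E m j * ((M - s * \<delta> j) / 2))"
      unfolding split using neighbours by simp
  qed (use pos(1) in simp)
  then have "d * M \<le> sqrt d * N + 2 * \<bar>g m\<bar> / \<beta>" using pos by (simp add: field_simps)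
  then have "M \<le> (sqrt d * N + 2 * \<bar>g m\<bar> / \<beta>) / d" using d by (simp add: field_simps)
  also have "\<dots> = N / sqrt d + 2 * \<bar>g m\<bar> / (\<beta> * d)"
  proof -
    define q where "q = sqrt d"
    have "q > 0" "d = q * q" using d by (simp_all add: q_def)
    then show ?thesis using pos(1) unfolding q_def[symmetric] by (simp add: field_simps)
  qed
  finally have "M \<le> N / sqrt d + 2 * \<bar>g m\<bar> / (\<beta> * d)" .
  then have bound: "\<bar>\<delta> i\<bar> \<le> N / sqrt d + 2 * \<bar>g m\<bar> / (\<beta> * d)" if "i < n" for i
    using max[OF that] by (simp add: M_def)
  show "\<exists>m<n. \<forall>i<n. \<bar>\<delta> i\<bar> \<le> sqrt (\<Sum>i<n. (\<delta> i)\<^sup>2) / sqrt (node_degree n E m)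
           + 2 * \<bar>g m\<bar> / (\<beta> * node_degree n E m)"
  proof (intro exI[of _ m] conjI allI impI)
    fix i assume "i < n"
    then show "\<bar>\<delta> i\<bar> \<le> sqrt (\<Sum>i<n. (\<delta> i)\<^sup>2) / sqrt (node_degree n E m)
           + 2 * \<bar>g m\<bar> / (\<beta> * node_degree n E m)"
      using bound unfolding N_def d_def by simp
  qed (rule m)
qed

section \<open>Concentration of the score\<close>

text \<open>
  Hoeffding's lemma with the optimal constant for a single comparison. For negative \<open>c\<close> exchange the two outcomes.
\<close>

lemma bernoulli_hoeffding:
  assumes p: "0 \<le> p" "p \<le> 1"
  shows "measure_pmf.expectation (bernoulli_pmf p) (\<lambda>v. exp (c * (of_bool v - p))) \<le> exp (c\<^sup>2 / 8)"
proof -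
  have main: "q * exp (h * (1 - q)) + (1 - q) * exp (- (h * q)) \<le> exp (h\<^sup>2 / 8)"
    if "h \<ge> 0" "0 \<le> q" for h q :: real
  proof -
    have pos: "0 < 1 + q * (exp h - 1)" using that by (simp add: add_pos_nonneg)
    have "q * exp (h * (1 - q)) + (1 - q) * exp (- (h * q)) = exp (- (h * q)) * (1 + q * (exp h - 1))"
      by (simp add: algebra_simps exp_diff exp_minus divide_inverse)
    also have "\<dots> = exp (- (h * q)) * exp (ln (1 + q * (exp h - 1)))"
      using pos by simp
    also have "\<dots> = exp (- h * q + ln (1 + q * (exp h - 1)))"
      unfolding exp_add by simp
    also have "\<dots> \<le> exp (h\<^sup>2 / 8)"
      using Hoeffdings_lemma_aux[OF that] by simp
    finally show ?thesis .
  qed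
  have "measure_pmf.expectation (bernoulli_pmf p) (\<lambda>v. exp (c * (of_bool v - p)))
      = p * exp (c * (1 - p)) + (1 - p) * exp (- (c * p))"
    using p by simp
  also have "\<dots> \<le> exp (c\<^sup>2 / 8)"
    using main[of c p] main[of "- c" "1 - p"] p by (cases "c \<ge> 0") (simp_all add: algebra_simps)
  finally show ?thesis .
qed

text \<open>
  The deviation of the observed from the expected frequency of wins, extended antisymmetrically from \<open>i < j\<close>
  to all pairs, so that the gradient of the likelihood becomes a sum over all neighbours.
\<close>

definition noise :: "nat \<Rightarrow> real vec \<Rightarrow> (nat \<times> nat \<times> nat \<Rightarrow> bool) \<Rightarrow> nat \<Rightarrow> nat \<Rightarrow> real" where
  "noise L \<theta> y i j =
     (if i < j then mean_outcome L y i j - logistic (\<theta> $ i - \<theta> $ j)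
      else if j < i then - (mean_outcome L y j i - logistic (\<theta> $ j - \<theta> $ i)) else 0)"

text \<open>
  The negative gradient of the negative log-likelihood at the true parameter.
\<close>

definition score :: "nat \<Rightarrow> (nat \<times> nat) set \<Rightarrow> nat \<Rightarrow> real vec \<Rightarrow> (nat \<times> nat \<times> nat \<Rightarrow> bool) \<Rightarrow> nat \<Rightarrow> real" where
  "score n E L \<theta> y i = (\<Sum>j<n. adj E i j * noise L \<theta> y i j)"

lemma noise_antisym: "noise L \<theta> y i j = - noise L \<theta> y j i"
  by (simp add: noise_def)

lemma score_pairing:
  assumes "simple_graph n E"
  shows "(\<Sum>i<n. u i * score n E L \<theta> y i) = (\<Sum>j<n. \<Sum>i<j. adj E i j * noise L \<theta> y i j * (u i - u j))"
  unfolding score_def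
proof (rule sum_antisymmetric_pairing)
  fix i j
  show "adj E i j * noise L \<theta> y i j = - (adj E j i * noise L \<theta> y j i)"
    by (simp only: noise_antisym[of L \<theta> y i j] adj_sym[OF assms, of i j] mult_minus_right)
qed

lemma comparisons_eq:
  "comparisons n E L = (\<lambda>(j, i, l). (i, j, l)) `
     (SIGMA j:{..<n}. SIGMA i:{..<j}. if (i, j) \<in> E then {..<L} else {})"
  by (auto simp: comparisons_def image_iff split: if_splits)

lemma finite_comparisons: "finite (comparisons n E L)"
  unfolding comparisons_eq by (intro finite_imageI finite_SigmaI) auto

lemma sum_comparisons:
  fixes h :: "nat \<times> nat \<times> nat \<Rightarrow> real"
  shows "(\<Sum>x\<in>comparisons n E L. h x) = (\<Sum>j<n. \<Sum>i<j. adj E i j * (\<Sum>l<L. h (i, j, l)))"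
proof -
  have "(\<Sum>x\<in>comparisons n E L. h x)
      = (\<Sum>(j, i, l)\<in>(SIGMA j:{..<n}. SIGMA i:{..<j}. if (i, j) \<in> E then {..<L} else {}). h (i, j, l))"
    unfolding comparisons_eq
    by (subst sum.reindex) (auto simp: inj_on_def split_def)
  also have "\<dots> = (\<Sum>j<n. \<Sum>(i, l)\<in>(SIGMA i:{..<j}. if (i, j) \<in> E then {..<L} else {}). h (i, j, l))"
    by (subst sum.Sigma[symmetric]) auto
  also have "\<dots> = (\<Sum>j<n. \<Sum>i<j. \<Sum>l\<in>(if (i, j) \<in> E then {..<L} else {}). h (i, j, l))"
    by (intro sum.cong refl, subst sum.Sigma[symmetric]) auto
  also have "\<dots> = (\<Sum>j<n. \<Sum>i<j. adj E i j * (\<Sum>l<L. h (i, j, l)))"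
    by (intro sum.cong) (auto simp: adj_def)
  finally show ?thesis .
qed

lemma finite_set_btl_pmf: "finite (set_pmf (btl_pmf n E L \<theta>))"
  unfolding btl_pmf_def
  by (rule finite_subset[OF set_Pi_pmf_subset'])
     (auto intro!: finite_PiE_dflt finite_comparisons)

text \<open>
  A linear form of the score is a sum of independent centred Bernoulli variables with weights
  \<open>(u i - u j) / L\<close>, and each edge carries \<open>L\<close> of them.
\<close>

lemma score_mgf:
  assumes graph: "simple_graph n E" and L: "L \<ge> 1"
  shows "measure_pmf.expectation (btl_pmf n E L \<theta>) (\<lambda>y. exp (\<Sum>i<n. u i * score n E L \<theta> y i))
      \<le> exp (dirichlet n E u / (8 * real L))"
proof -
  define c where "c = (\<lambda>(i, j, l :: nat). (u i - u j) / real L)"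
  define p where "p = (\<lambda>(i, j, l :: nat). logistic (\<theta> $ i - \<theta> $ j))"
  have p01: "0 \<le> p x" "p x \<le> 1" for x
    by (simp_all add: p_def split_def logistic_def add_pos_pos field_simps)
  have lin: "(\<Sum>i<n. u i * score n E L \<theta> y i)
      = (\<Sum>x\<in>comparisons n E L. c x * (of_bool (y x) - p x))" for y
  proof -
    have "(\<Sum>x\<in>comparisons n E L. c x * (of_bool (y x) - p x))
        = (\<Sum>j<n. \<Sum>i<j. adj E i j * (\<Sum>l<L. (u i - u j) / real L * (of_bool (y (i, j, l)) - logistic (\<theta> $ i - \<theta> $ j))))"
      by (simp add: sum_comparisons c_def p_def)
    also have "\<dots> = (\<Sum>j<n. \<Sum>i<j. adj E i j * noise L \<theta> y i j * (u i - u j))"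
    proof (intro sum.cong refl)
      fix i j assume "j \<in> {..<n}" and ij: "i \<in> {..<j}"
      define W :: real where "W = (\<Sum>l<L. of_bool (y (i, j, l)))"
      have "(\<Sum>l<L. (u i - u j) / real L * (of_bool (y (i, j, l)) - logistic (\<theta> $ i - \<theta> $ j)))
          = (u i - u j) / real L * (W - real L * logistic (\<theta> $ i - \<theta> $ j))"
        by (simp only: sum_distrib_left[symmetric] sum_subtractf W_def sum_constant card_lessThan)
      also have "\<dots> = (u i - u j) * (W / real L - logistic (\<theta> $ i - \<theta> $ j))"
        using L by (simp add: field_simps)
      also have "W / real L - logistic (\<theta> $ i - \<theta> $ j) = noise L \<theta> y i j"
        using ij by (simp add: noise_def mean_outcome_def W_def)
      finally have "(\<Sum>l<L. (u i - u j) / real L * (of_bool (y (i, j, l)) - logistic (\<theta> $ i - \<theta> $ j)))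
          = (u i - u j) * noise L \<theta> y i j" .
      then show "adj E i j * (\<Sum>l<L. (u i - u j) / real L * (of_bool (y (i, j, l)) - logistic (\<theta> $ i - \<theta> $ j)))
          = adj E i j * noise L \<theta> y i j * (u i - u j)" by simp
    qed
    finally show ?thesis by (simp add: score_pairing[OF graph])
  qed
  have law: "btl_pmf n E L \<theta> = Pi_pmf (comparisons n E L) False (\<lambda>x. bernoulli_pmf (p x))"
    unfolding btl_pmf_def p_def by (intro arg_cong[of _ _ "Pi_pmf _ _"] ext) (simp split: prod.split)
  have "measure_pmf.expectation (btl_pmf n E L \<theta>) (\<lambda>y. exp (\<Sum>i<n. u i * score n E L \<theta> y i))
      = measure_pmf.expectation (Pi_pmf (comparisons n E L) False (\<lambda>x. bernoulli_pmf (p x)))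
          (\<lambda>y. \<Prod>x\<in>comparisons n E L. exp (c x * (of_bool (y x) - p x)))"
    by (simp only: lin law exp_sum[OF finite_comparisons])
  also have "\<dots> = (\<Prod>x\<in>comparisons n E L. measure_pmf.expectation (bernoulli_pmf (p x))
      (\<lambda>v. exp (c x * (of_bool v - p x))))"
    by (intro expectation_prod_Pi_pmf finite_comparisons integrable_measure_pmf_finite finite_code) simp_all
  also have "\<dots> \<le> (\<Prod>x\<in>comparisons n E L. exp ((c x)\<^sup>2 / 8))"
    by (intro prod_mono conjI bernoulli_hoeffding p01 Bochner_Integration.integral_nonneg) simp_all
  also have "\<dots> = exp (\<Sum>x\<in>comparisons n E L. (c x)\<^sup>2 / 8)"
    by (simp add: exp_sum finite_comparisons)
  also have "(\<Sum>x\<in>comparisons n E L. (c x)\<^sup>2 / 8) = dirichlet n E u / (8 * real L)"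
  proof -
    have "(\<Sum>x\<in>comparisons n E L. (c x)\<^sup>2 / 8)
        = (\<Sum>j<n. \<Sum>i<j. adj E i j * (real L * (((u i - u j) / real L)\<^sup>2 / 8)))"
      by (simp add: sum_comparisons c_def)
    also have "\<dots> = (\<Sum>j<n. \<Sum>i<j. adj E i j * (u i - u j)\<^sup>2 / (8 * real L))"
      using L by (intro sum.cong refl) (simp add: power_divide power2_eq_square)
    finally show ?thesis by (simp add: dirichlet_def sum_divide_distrib)
  qed
  finally show ?thesis .
qed

lemma chernoff_pmf:
  fixes X :: "'a \<Rightarrow> real"
  assumes "finite (set_pmf p)"
  shows "measure_pmf.prob p {y. a \<le> X y} \<le> exp (- a) * measure_pmf.expectation p (\<lambda>y. exp (X y))"
proof -
  have "measure_pmf.prob p {y. a \<le> X y} = measure_pmf.expectation p (indicator {y. a \<le> X y})" by simp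
  also have "\<dots> \<le> measure_pmf.expectation p (\<lambda>y. exp (- a) * exp (X y))"
    by (intro integral_mono integrable_measure_pmf_finite assms)
       (auto simp: indicator_def simp flip: exp_add)
  finally show ?thesis by simp
qed

lemma nn_integral_std_normal_exp_linear:
  "(\<integral>\<^sup>+x. ennreal (exp (c * x) * std_normal_density x) \<partial>lborel) = ennreal (exp (c\<^sup>2 / 2))"
proof -
  have "exp (c * x) * std_normal_density x = exp (c\<^sup>2 / 2) * normal_density c 1 x" for x
  proof -
    have "exp (c * x) * exp (- x\<^sup>2 / 2) = exp (c\<^sup>2 / 2) * exp (- (x - c)\<^sup>2 / 2)"
      by (simp flip: exp_add) (simp add: power2_eq_square field_simps)
    then show ?thesis by (simp add: normal_density_def field_simps)
  qed
  then have "(\<integral>\<^sup>+x. ennreal (exp (c * x) * std_normal_density x) \<partial>lborel)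
      = (\<integral>\<^sup>+x. ennreal (exp (c\<^sup>2 / 2)) * ennreal (normal_density c 1 x) \<partial>lborel)"
    by (simp add: ennreal_mult)
  also have "\<dots> = ennreal (exp (c\<^sup>2 / 2)) * (\<integral>\<^sup>+x. ennreal (normal_density c 1 x) \<partial>lborel)"
    by (rule nn_integral_cmult) simp
  also have "(\<integral>\<^sup>+x. ennreal (normal_density c 1 x) \<partial>lborel) = 1"
    using nn_integral_eq_integral[OF integrable_normal_density[of 1 c]] by simp
  finally show ?thesis by simp
qed

lemma nn_integral_std_normal_exp_square:
  "(\<integral>\<^sup>+x. ennreal (exp (x\<^sup>2 / 4) * std_normal_density x) \<partial>lborel) = ennreal (sqrt 2)"
proof -
  have "exp (x\<^sup>2 / 4) * std_normal_density x = sqrt 2 * normal_density 0 (sqrt 2) x" for x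
  proof -
    have "exp (x\<^sup>2 / 4) * exp (- x\<^sup>2 / 2) = exp (- x\<^sup>2 / 4)"
      by (simp flip: exp_add)
    then show ?thesis by (simp add: normal_density_def field_simps real_sqrt_mult)
  qed
  then have "(\<integral>\<^sup>+x. ennreal (exp (x\<^sup>2 / 4) * std_normal_density x) \<partial>lborel)
      = (\<integral>\<^sup>+x. ennreal (sqrt 2) * ennreal (normal_density 0 (sqrt 2) x) \<partial>lborel)"
    by (simp add: ennreal_mult)
  also have "\<dots> = ennreal (sqrt 2) * (\<integral>\<^sup>+x. ennreal (normal_density 0 (sqrt 2) x) \<partial>lborel)"
    by (rule nn_integral_cmult) simp
  also have "(\<integral>\<^sup>+x. ennreal (normal_density 0 (sqrt 2) x) \<partial>lborel) = 1"
    using nn_integral_eq_integral[OF integrable_normal_density[of "sqrt 2" 0]] by simp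
  finally show ?thesis by simp
qed

text \<open>
  Since \<open>exp (c\<^sup>2 / 2)\<close> is the expectation of \<open>exp (c x)\<close> for a standard normal \<open>x\<close>, the exponential of half
  the squared norm is a Gaussian average of exponentials of linear forms. Exchanging the two expectations and
  using the hypothesis leaves a product of Gaussian integrals of \<open>exp (x\<^sup>2 / 4)\<close>, each equal to \<open>sqrt 2\<close>.
\<close>

lemma subgaussian_norm_mgf:
  fixes Z :: "'a \<Rightarrow> nat \<Rightarrow> real"
  assumes fin: "finite (set_pmf p)"
    and subgauss: "\<And>u. measure_pmf.expectation p (\<lambda>y. exp (\<Sum>i<n. u i * Z y i)) \<le> exp ((\<Sum>i<n. (u i)\<^sup>2) / 4)"
  shows "measure_pmf.expectation p (\<lambda>y. exp ((\<Sum>i<n. (Z y i)\<^sup>2) / 2)) \<le> sqrt 2 ^ n"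
proof -
  interpret product_sigma_finite "\<lambda>_ :: nat. lborel :: real measure" ..
  let ?P = "Pi\<^sub>M {..<n} (\<lambda>_. lborel :: real measure)"
  define \<phi> where "\<phi> = (\<lambda>x :: nat \<Rightarrow> real. \<Prod>i<n. std_normal_density (x i))"
  have \<phi>: "\<phi> x \<ge> 0" for x by (simp add: \<phi>_def prod_nonneg)
  have gauss: "ennreal (exp ((\<Sum>i<n. (Z y i)\<^sup>2) / 2)) = (\<integral>\<^sup>+x. ennreal (exp (\<Sum>i<n. x i * Z y i) * \<phi> x) \<partial>?P)" for y
  proof -
    have "ennreal (exp ((\<Sum>i<n. (Z y i)\<^sup>2) / 2)) = (\<Prod>i<n. ennreal (exp ((Z y i)\<^sup>2 / 2)))"
      by (simp add: exp_sum sum_divide_distrib prod_ennreal)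
    also have "\<dots> = (\<Prod>i<n. \<integral>\<^sup>+x. ennreal (exp (Z y i * x) * std_normal_density x) \<partial>lborel)"
      by (simp only: nn_integral_std_normal_exp_linear)
    also have "\<dots> = (\<integral>\<^sup>+x. (\<Prod>i<n. ennreal (exp (Z y i * x i) * std_normal_density (x i))) \<partial>?P)"
      by (rule product_nn_integral_prod[symmetric]) simp_all
    also have "\<dots> = (\<integral>\<^sup>+x. ennreal (exp (\<Sum>i<n. x i * Z y i) * \<phi> x) \<partial>?P)"
      by (simp add: prod_ennreal exp_sum prod.distrib \<phi>_def mult.commute)
    finally show ?thesis .
  qed
  have meas: "(\<lambda>x. ennreal (exp (\<Sum>i<n. x i * Z y i) * \<phi> x)) \<in> borel_measurable ?P" for y
    unfolding \<phi>_def by measurable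
  have "ennreal (measure_pmf.expectation p (\<lambda>y. exp ((\<Sum>i<n. (Z y i)\<^sup>2) / 2)))
      = (\<integral>\<^sup>+y. ennreal (exp ((\<Sum>i<n. (Z y i)\<^sup>2) / 2)) \<partial>measure_pmf p)"
    by (rule nn_integral_eq_integral[symmetric]) (auto intro: integrable_measure_pmf_finite[OF fin])
  also have "\<dots> = (\<Sum>y\<in>set_pmf p. ennreal (exp ((\<Sum>i<n. (Z y i)\<^sup>2) / 2)) * ennreal (pmf p y))"
    by (rule nn_integral_measure_pmf_finite[OF fin]) simp
  also have "\<dots> = (\<Sum>y\<in>set_pmf p. \<integral>\<^sup>+x. ennreal (exp (\<Sum>i<n. x i * Z y i) * \<phi> x) * ennreal (pmf p y) \<partial>?P)"
    unfolding gauss by (intro sum.cong refl nn_integral_multc[symmetric] meas)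
  also have "\<dots> = (\<integral>\<^sup>+x. (\<Sum>y\<in>set_pmf p. ennreal (exp (\<Sum>i<n. x i * Z y i) * \<phi> x) * ennreal (pmf p y)) \<partial>?P)"
    by (intro nn_integral_sum[symmetric] borel_measurable_times_ennreal meas borel_measurable_const)
  also have "\<dots> \<le> (\<integral>\<^sup>+x. (\<Prod>i<n. ennreal (exp ((x i)\<^sup>2 / 4) * std_normal_density (x i))) \<partial>?P)"
  proof (rule nn_integral_mono)
    fix x
    have "(\<Sum>y\<in>set_pmf p. ennreal (exp (\<Sum>i<n. x i * Z y i) * \<phi> x) * ennreal (pmf p y))
        = (\<Sum>y\<in>set_pmf p. ennreal (exp (\<Sum>i<n. x i * Z y i) * \<phi> x * pmf p y))"
      by (intro sum.cong refl ennreal_mult[symmetric] mult_nonneg_nonneg \<phi>) simp_all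
    also have "\<dots> = ennreal (\<Sum>y\<in>set_pmf p. exp (\<Sum>i<n. x i * Z y i) * \<phi> x * pmf p y)"
      by (intro sum_ennreal mult_nonneg_nonneg \<phi>) simp_all
    also have "(\<Sum>y\<in>set_pmf p. exp (\<Sum>i<n. x i * Z y i) * \<phi> x * pmf p y)
        = \<phi> x * measure_pmf.expectation p (\<lambda>y. exp (\<Sum>i<n. x i * Z y i))"
      by (simp add: integral_measure_pmf_real[OF fin] sum_distrib_left mult_ac)
    also have "\<dots> \<le> \<phi> x * exp ((\<Sum>i<n. (x i)\<^sup>2) / 4)"
      using subgauss \<phi> by (intro mult_left_mono)
    also have "\<dots> = (\<Prod>i<n. exp ((x i)\<^sup>2 / 4) * std_normal_density (x i))"
      by (simp add: \<phi>_def sum_divide_distrib exp_sum prod.distrib mult.commute)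
    finally show "(\<Sum>y\<in>set_pmf p. ennreal (exp (\<Sum>i<n. x i * Z y i) * \<phi> x) * ennreal (pmf p y))
        \<le> (\<Prod>i<n. ennreal (exp ((x i)\<^sup>2 / 4) * std_normal_density (x i)))"
      by (simp add: prod_ennreal ennreal_leI)
  qed
  also have "\<dots> = (\<Prod>i<n. \<integral>\<^sup>+x. ennreal (exp (x\<^sup>2 / 4) * std_normal_density x) \<partial>lborel)"
    by (rule product_nn_integral_prod) simp_all
  also have "\<dots> = ennreal (sqrt 2 ^ n)"
    by (simp add: nn_integral_std_normal_exp_square ennreal_power)
  finally show ?thesis by simp
qed


text \<open>
  The scaling \<open>s\<close> makes the variance proxy exactly the one of \<open>subgaussian_norm_mgf\<close>, because the Dirichlet
  form is at most \<open>2 d\<close> times the squared norm.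
\<close>

lemma score_norm_tail:
  assumes graph: "simple_graph n E" and L: "L \<ge> 1" and d: "d > 0"
    and deg: "\<And>i. i < n \<Longrightarrow> node_degree n E i \<le> d"
  shows "measure_pmf.prob (btl_pmf n E L \<theta>) {y. 4 * real n * d / real L \<le> (\<Sum>i<n. (score n E L \<theta> y i)\<^sup>2)}
      \<le> exp (- real n)"
proof -
  define s where "s = sqrt (real L / d)"
  have s: "s\<^sup>2 = real L / d" "real L > 0" using L d by (simp_all add: s_def)
  define Z where "Z = (\<lambda>y i. s * score n E L \<theta> y i)"
  have sub: "measure_pmf.expectation (btl_pmf n E L \<theta>) (\<lambda>y. exp (\<Sum>i<n. u i * Z y i))
      \<le> exp ((\<Sum>i<n. (u i)\<^sup>2) / 4)" for u
  proof -
    have "measure_pmf.expectation (btl_pmf n E L \<theta>) (\<lambda>y. exp (\<Sum>i<n. u i * Z y i))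
        = measure_pmf.expectation (btl_pmf n E L \<theta>) (\<lambda>y. exp (\<Sum>i<n. (s * u i) * score n E L \<theta> y i))"
      by (simp add: Z_def mult_ac)
    also have "\<dots> \<le> exp (dirichlet n E (\<lambda>i. s * u i) / (8 * real L))"
      by (rule score_mgf[OF graph L])
    also have "\<dots> \<le> exp ((\<Sum>i<n. (u i)\<^sup>2) / 4)"
    proof -
      have "dirichlet n E (\<lambda>i. s * u i) \<le> 2 * (\<Sum>i<n. node_degree n E i * (s * u i)\<^sup>2)"
        by (rule dirichlet_le_degrees[OF graph])
      also have "\<dots> \<le> 2 * (\<Sum>i<n. d * (s * u i)\<^sup>2)"
        by (intro mult_left_mono sum_mono mult_right_mono deg) auto
      also have "\<dots> = 2 * real L * (\<Sum>i<n. (u i)\<^sup>2)"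
        using d by (simp add: power_mult_distrib s sum_distrib_left mult_ac)
      finally show ?thesis using s(2) by (simp add: field_simps)
    qed
    finally show ?thesis .
  qed
  have "{y. 4 * real n * d / real L \<le> (\<Sum>i<n. (score n E L \<theta> y i)\<^sup>2)} = {y. 2 * real n \<le> (\<Sum>i<n. (Z y i)\<^sup>2) / 2}"
  proof -
    have scale: "(\<Sum>i<n. (Z y i)\<^sup>2) = real L / d * (\<Sum>i<n. (score n E L \<theta> y i)\<^sup>2)" for y
      by (simp add: Z_def power_mult_distrib s sum_distrib_left)
    show ?thesis unfolding scale using s(2) d by (simp add: field_simps)
  qed
  then have "measure_pmf.prob (btl_pmf n E L \<theta>) {y. 4 * real n * d / real L \<le> (\<Sum>i<n. (score n E L \<theta> y i)\<^sup>2)}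
      \<le> exp (- (2 * real n)) * measure_pmf.expectation (btl_pmf n E L \<theta>) (\<lambda>y. exp ((\<Sum>i<n. (Z y i)\<^sup>2) / 2))"
    using chernoff_pmf[OF finite_set_btl_pmf, of n E L \<theta> "2 * real n" "\<lambda>y. (\<Sum>i<n. (Z y i)\<^sup>2) / 2"] by (simp only:)
  also have "\<dots> \<le> exp (- (2 * real n)) * sqrt 2 ^ n"
    by (intro mult_left_mono subgaussian_norm_mgf finite_set_btl_pmf sub) simp
  also have "\<dots> \<le> exp (- (2 * real n)) * exp (real n)"
  proof (intro mult_left_mono)
    have "sqrt 2 \<le> exp 1" using exp_ge_add_one_self[of 1] real_sqrt_le_mono[of 2 4] by simp
    then have "sqrt 2 ^ n \<le> exp 1 ^ n" by (intro power_mono) auto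
    then show "sqrt 2 ^ n \<le> exp (real n)" by (simp flip: exp_of_nat_mult)
  qed simp
  also have "\<dots> = exp (- real n)" by (simp flip: exp_add)
  finally show ?thesis .
qed

lemma score_coordinate_tail:
  assumes graph: "simple_graph n E" and L: "L \<ge> 1" and m: "m < n" and d: "node_degree n E m > 0"
    and t: "t \<ge> 0"
  shows "measure_pmf.prob (btl_pmf n E L \<theta>) {y. t \<le> \<bar>score n E L \<theta> y m\<bar>}
      \<le> 2 * exp (- (2 * t\<^sup>2 * real L / node_degree n E m))"
proof -
  define d where "d = node_degree n E m"
  \<comment> \<open>the minimiser of \<open>- h t + h\<^sup>2 d / (8 L)\<close>\<close>
  define h where "h = 4 * t * real L / d"
  have dL: "d > 0" "real L > 0" using assms by (simp_all add: d_def)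
  then have h: "h \<ge> 0" using t by (simp add: h_def)
  have one: "measure_pmf.prob (btl_pmf n E L \<theta>) {y. t \<le> \<sigma> * score n E L \<theta> y m}
      \<le> exp (- (2 * t\<^sup>2 * real L / d))" if \<sigma>: "\<sigma>\<^sup>2 = 1" for \<sigma> :: real
  proof -
    let ?u = "\<lambda>i. of_bool (i = m) * (h * \<sigma>) + 0 :: real"
    have lin: "(\<Sum>i<n. ?u i * score n E L \<theta> y i) = h * (\<sigma> * score n E L \<theta> y m)" for y
    proof -
      have "(\<Sum>i<n. ?u i * score n E L \<theta> y i) = (\<Sum>i<n. if i = m then h * (\<sigma> * score n E L \<theta> y m) else 0)"
        by (intro sum.cong) auto
      then show ?thesis using m by simp
    qed
    have "measure_pmf.prob (btl_pmf n E L \<theta>) {y. t \<le> \<sigma> * score n E L \<theta> y m}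
        \<le> measure_pmf.prob (btl_pmf n E L \<theta>) {y. h * t \<le> (\<Sum>i<n. ?u i * score n E L \<theta> y i)}"
      unfolding lin by (intro measure_pmf.finite_measure_mono) (auto intro: mult_left_mono[OF _ h])
    also have "\<dots> \<le> exp (- (h * t)) * measure_pmf.expectation (btl_pmf n E L \<theta>)
        (\<lambda>y. exp (\<Sum>i<n. ?u i * score n E L \<theta> y i))"
      by (rule chernoff_pmf[OF finite_set_btl_pmf])
    also have "\<dots> \<le> exp (- (h * t)) * exp (dirichlet n E ?u / (8 * real L))"
      by (intro mult_left_mono score_mgf[OF graph L]) simp
    also have "\<dots> = exp (- (h * t) + (h\<^sup>2 * d) / (8 * real L))"
      using \<sigma> by (simp only: dirichlet_point[OF graph m] exp_add power_mult_distrib d_def mult_1_right)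
    also have "- (h * t) + (h\<^sup>2 * d) / (8 * real L) = - (2 * t\<^sup>2 * real L / d)"
      using dL by (simp add: h_def power2_eq_square field_simps)
    finally show ?thesis .
  qed
  have "measure_pmf.prob (btl_pmf n E L \<theta>) {y. t \<le> \<bar>score n E L \<theta> y m\<bar>}
      \<le> measure_pmf.prob (btl_pmf n E L \<theta>) ({y. t \<le> 1 * score n E L \<theta> y m} \<union> {y. t \<le> - 1 * score n E L \<theta> y m})"
    by (intro measure_pmf.finite_measure_mono) (auto simp: abs_real_def split: if_splits)
  also have "\<dots> \<le> measure_pmf.prob (btl_pmf n E L \<theta>) {y. t \<le> 1 * score n E L \<theta> y m}
      + measure_pmf.prob (btl_pmf n E L \<theta>) {y. t \<le> - 1 * score n E L \<theta> y m}"
    by (rule measure_Un_le) simp_all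
  also have "\<dots> \<le> exp (- (2 * t\<^sup>2 * real L / d)) + exp (- (2 * t\<^sup>2 * real L / d))"
    by (intro add_mono one) simp_all
  finally show ?thesis by (simp add: d_def)
qed

lemma exp_minus_le_power4:
  assumes "n \<ge> 1"
  shows "exp (- real n) \<le> 256 / real n ^ 4"
proof -
  have "real n / 4 \<le> exp (real n / 4)" using exp_ge_add_one_self[of "real n / 4"] by linarith
  then have "(real n / 4) ^ 4 \<le> exp (real n / 4) ^ 4" by (rule power_mono) simp
  also have "\<dots> = exp (real n)" by (simp flip: exp_of_nat_mult)
  finally have "real n ^ 4 \<le> 256 * exp (real n)" by (simp add: power_divide)
  then show ?thesis using assms by (simp add: exp_minus field_simps)
qed

text \<open>
  The factor \<open>5 / 2\<close> makes each coordinate fail with probability at most \<open>2 n\<^sup>-\<^sup>5\<close>, hence some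
  coordinate with probability at most \<open>2 n\<^sup>-\<^sup>4\<close>; the norm adds \<open>exp (- n) \<le> 256 n\<^sup>-\<^sup>4\<close>.
\<close>

lemma score_concentration:
  assumes graph: "simple_graph n E" and n: "n \<ge> 2" and L: "L \<ge> 1"
    and d: "\<And>i. i < n \<Longrightarrow> 0 < node_degree n E i" "\<And>i. i < n \<Longrightarrow> node_degree n E i \<le> d"
  shows "1 - 258 / real n ^ 4 \<le> measure_pmf.prob (btl_pmf n E L \<theta>)
     {y. (\<Sum>i<n. (score n E L \<theta> y i)\<^sup>2) \<le> 4 * real n * d / real L \<and>
         (\<forall>m<n. \<bar>score n E L \<theta> y m\<bar> \<le> sqrt (5 / 2 * node_degree n E m * ln (real n) / real L))}"
proof -
  let ?prob = "measure_pmf.prob (btl_pmf n E L \<theta>)"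
  let ?good = "{y. (\<Sum>i<n. (score n E L \<theta> y i)\<^sup>2) \<le> 4 * real n * d / real L \<and>
         (\<forall>m<n. \<bar>score n E L \<theta> y m\<bar> \<le> sqrt (5 / 2 * node_degree n E m * ln (real n) / real L))}"
  have dpos: "d > 0" using d[of 0] n by simp
  define t where "t = (\<lambda>m. sqrt (5 / 2 * node_degree n E m * ln (real n) / real L))"
  define A where "A = {y. 4 * real n * d / real L \<le> (\<Sum>i<n. (score n E L \<theta> y i)\<^sup>2)}"
  define B where "B = (\<lambda>m. {y. t m \<le> \<bar>score n E L \<theta> y m\<bar>})"
  have PA: "?prob A \<le> 256 / real n ^ 4"
    unfolding A_def
    by (rule order_trans[OF score_norm_tail[OF graph L dpos d(2)] exp_minus_le_power4]) (use n in simp_all)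
  have PB: "?prob (B m) \<le> 2 / real n ^ 5" if m: "m < n" for m
  proof -
    have arg: "0 \<le> 5 / 2 * node_degree n E m * ln (real n) / real L"
      using d(1)[OF m] n by simp
    have "?prob (B m) \<le> 2 * exp (- (2 * (t m)\<^sup>2 * real L / node_degree n E m))"
      unfolding B_def using arg by (intro score_coordinate_tail[OF graph L m d(1)[OF m]]) (simp add: t_def)
    also have "2 * (t m)\<^sup>2 * real L / node_degree n E m = 5 * ln (real n)"
      using arg d(1)[OF m] L by (simp add: t_def)
    also have "exp (- (5 * ln (real n))) = 1 / real n ^ 5"
    proof -
      have "exp (5 * ln (real n)) = exp (ln (real n)) ^ 5" using exp_of_nat_mult[of 5 "ln (real n)"] by simp
      then show ?thesis using n by (simp add: exp_minus inverse_eq_divide)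
    qed
    finally show ?thesis by simp
  qed
  have "?prob (UNIV - ?good) \<le> ?prob (A \<union> (\<Union>m\<in>{..<n}. B m))"
    by (intro measure_pmf.finite_measure_mono) (auto simp: A_def B_def t_def not_le)
  also have "\<dots> \<le> ?prob A + ?prob (\<Union>m\<in>{..<n}. B m)"
    by (rule measure_Un_le) simp_all
  also have "?prob (\<Union>m\<in>{..<n}. B m) \<le> (\<Sum>m<n. ?prob (B m))"
    by (rule measure_UNION_le) simp_all
  also have "\<dots> \<le> (\<Sum>m<n. 2 / real n ^ 5)" by (intro sum_mono PB) simp
  also have "\<dots> = 2 / real n ^ 4" using n by (simp add: power_Suc[of _ 4] eval_nat_numeral)
  finally have "?prob (UNIV - ?good) \<le> 258 / real n ^ 4" using PA by (simp add: add_divide_distrib[symmetric])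
  then show ?thesis using measure_pmf.prob_compl[of ?good "btl_pmf n E L \<theta>"] by simp
qed

section \<open>The regularised estimator\<close>

text \<open>
  The regularised objective on functions instead of vectors, for which the product topology is available.
\<close>

definition objective ::
  "nat \<Rightarrow> (nat \<times> nat) set \<Rightarrow> nat \<Rightarrow> real \<Rightarrow> (nat \<times> nat \<times> nat \<Rightarrow> bool) \<Rightarrow> (nat \<Rightarrow> real) \<Rightarrow> real" where
  "objective n E L \<rho> y x =
     - (\<Sum>j<n. \<Sum>i<j. adj E i j *
          (mean_outcome L y i j * ln (logistic (x i - x j)) +
           (1 - mean_outcome L y i j) * ln (1 - logistic (x i - x j)))) + \<rho> / 2 * (\<Sum>i<n. (x i)\<^sup>2)"

lemma l2_norm_sq: "v \<in> carrier_vec n \<Longrightarrow> (l2_norm v)\<^sup>2 = (\<Sum>i<n. (v $ i)\<^sup>2)"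
  by (simp add: l2_norm_def scalar_prod_def lessThan_atLeast0 power2_eq_square sum_nonneg)

lemma objective_vec:
  assumes "v \<in> carrier_vec n"
  shows "neg_log_likelihood n E L y v + \<rho> / 2 * (l2_norm v)\<^sup>2 = objective n E L \<rho> y (\<lambda>i. v $ i)"
  unfolding neg_log_likelihood_def objective_def l2_norm_sq[OF assms]
  by (intro arg_cong2[of _ _ _ _ "(+)"] arg_cong[of _ _ uminus] sum.cong refl)
     (simp add: adj_mat_index)

lemma objective_cong: "(\<And>i. i < n \<Longrightarrow> x i = x' i) \<Longrightarrow> objective n E L \<rho> y x = objective n E L \<rho> y x'"
  unfolding objective_def
  by (intro arg_cong2[of _ _ _ _ "(+)"] arg_cong2[of _ _ _ _ "(*)"] arg_cong[of _ _ uminus] sum.cong refl)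
     simp_all

lemma mean_outcome_01: "0 \<le> mean_outcome L y i j" "mean_outcome L y i j \<le> 1"
proof -
  have "(\<Sum>l<L. of_bool (y (i, j, l)) :: real) \<le> (\<Sum>l<L. 1)" by (intro sum_mono) simp
  then show "mean_outcome L y i j \<le> 1"
    by (cases "L = 0") (simp_all add: mean_outcome_def del: sum_of_bool_eq)
  show "0 \<le> mean_outcome L y i j" by (simp add: mean_outcome_def sum_nonneg del: sum_of_bool_eq)
qed

lemma objective_ge_penalty: "\<rho> / 2 * (\<Sum>i<n. (x i)\<^sup>2) \<le> objective n E L \<rho> y x"
proof -
  have "adj E i j * (mean_outcome L y i j * ln (logistic (x i - x j)) +
           (1 - mean_outcome L y i j) * ln (1 - logistic (x i - x j))) \<le> 0" for i j
  proof (intro mult_nonneg_nonpos add_nonpos_nonpos)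
    show "ln (logistic (x i - x j)) \<le> 0"
      using logistic_pos logistic_less_1 by (intro ln_le_zero_iff[THEN iffD2]) (auto intro: less_imp_le)
    show "ln (1 - logistic (x i - x j)) \<le> 0"
      using logistic_pos[of "x i - x j"] logistic_less_1[of "x i - x j"] by simp
  qed (simp_all add: mean_outcome_01)
  then have "(\<Sum>j<n. \<Sum>i<j. adj E i j * (mean_outcome L y i j * ln (logistic (x i - x j)) +
           (1 - mean_outcome L y i j) * ln (1 - logistic (x i - x j)))) \<le> 0"
    by (intro sum_nonpos) auto
  then show ?thesis by (simp add: objective_def)
qed

lemma continuous_on_objective: "continuous_on UNIV (objective n E L \<rho> y)"
proof -
  have nz: "1 + exp (- s) \<noteq> 0" for s :: real
    using exp_gt_zero[of "- s"] by linarith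
  have log: "continuous_on UNIV (\<lambda>x. logistic (x i - x j))" for i j :: nat
    unfolding logistic_def
    by (intro continuous_intros continuous_on_product_coordinates ballI nz)
  have ne: "logistic t \<noteq> 0" "1 - logistic t \<noteq> 0" for t
    using logistic_pos[of t] logistic_less_1[of t] by auto
  show ?thesis
    unfolding objective_def
    by (intro continuous_intros log ballI ne continuous_on_product_coordinates)
qed

text \<open>
  The penalty makes the objective coercive: outside the box of radius \<open>R\<close> it exceeds its value at 0.
\<close>

lemma objective_minimizer_exists:
  assumes "\<rho> > 0"
  shows "\<exists>x. (\<Sum>i<n. x i) = 0 \<and> (\<forall>x'. (\<Sum>i<n. x' i) = 0 \<longrightarrow> objective n E L \<rho> y x \<le> objective n E L \<rho> y x')"
proof -
  define F where "F = objective n E L \<rho> y"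
  define R where "R = sqrt (2 * F (\<lambda>_. 0) / \<rho>)"
  define X where "X = {x :: nat \<Rightarrow> real. (\<forall>i. x i \<in> (if i < n then {- R..R} else {0})) \<and> (\<Sum>i<n. x i) = 0}"
  have F0: "F (\<lambda>_. 0) \<ge> 0" using objective_ge_penalty[of \<rho> "\<lambda>_. 0" n E L y] by (simp add: F_def)
  have R: "R \<ge> 0" "\<rho> / 2 * R\<^sup>2 = F (\<lambda>_. 0)" using F0 assms by (simp_all add: R_def)
  have "compact X" unfolding X_def by (rule compact_centered_box)
  moreover have zero: "(\<lambda>_. 0) \<in> X" using R by (simp add: X_def)
  moreover have "continuous_on X F"
    unfolding F_def by (rule continuous_on_subset[OF continuous_on_objective]) simp
  ultimately obtain x where x: "x \<in> X" and min: "\<And>x'. x' \<in> X \<Longrightarrow> F x \<le> F x'"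
    using continuous_attains_inf[of X F] by blast
  have "F x \<le> F x'" if x': "(\<Sum>i<n. x' i) = 0" for x'
  proof (cases "\<forall>i<n. \<bar>x' i\<bar> \<le> R")
    case True
    define z where "z = (\<lambda>i. if i < n then x' i else 0)"
    have "z \<in> X" using True x' by (auto simp: X_def z_def abs_le_iff)
    then have "F x \<le> F z" by (rule min)
    also have "F z = F x'" unfolding F_def by (rule objective_cong) (simp add: z_def)
    finally show ?thesis .
  next
    case False
    then obtain i where i: "i < n" "R < \<bar>x' i\<bar>" by auto
    have "F x \<le> F (\<lambda>_. 0)" by (rule min[OF zero])
    also have "\<dots> \<le> \<rho> / 2 * (x' i)\<^sup>2"
      unfolding R(2)[symmetric] using i R(1) assms by (intro mult_left_mono) (auto simp: abs_le_square_iff[symmetric])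
    also have "\<dots> \<le> \<rho> / 2 * (\<Sum>i<n. (x' i)\<^sup>2)"
      using i assms by (intro mult_left_mono member_le_sum) auto
    also have "\<dots> \<le> F x'" unfolding F_def by (rule objective_ge_penalty)
    finally show ?thesis .
  qed
  then show ?thesis using x unfolding F_def X_def by blast
qed

lemma centered_vecs_iff: "v \<in> centered_vecs n \<longleftrightarrow> v \<in> carrier_vec n \<and> (\<Sum>i<n. v $ i) = 0"
  unfolding centered_vecs_def by (auto simp: scalar_prod_def lessThan_atLeast0)

lemma reg_mle_minimizes:
  assumes "\<rho> > 0"
  shows "reg_mle n E L \<rho> y \<in> centered_vecs n"
    and "(\<Sum>i<n. x i) = 0 \<Longrightarrow> objective n E L \<rho> y (\<lambda>i. reg_mle n E L \<rho> y $ i) \<le> objective n E L \<rho> y x"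
proof -
  let ?f = "\<lambda>v. neg_log_likelihood n E L y v + \<rho> / 2 * (l2_norm v)\<^sup>2"
  obtain x0 where x0: "(\<Sum>i<n. x0 i) = 0"
    and min: "\<And>x. (\<Sum>i<n. x i) = 0 \<Longrightarrow> objective n E L \<rho> y x0 \<le> objective n E L \<rho> y x"
    using objective_minimizer_exists[OF assms] by blast
  have c0: "vec n x0 \<in> centered_vecs n" using x0 by (simp add: centered_vecs_iff)
  have f0: "?f (vec n x0) = objective n E L \<rho> y x0"
    by (subst objective_vec[of _ n]) (auto intro: objective_cong)
  have "is_arg_min ?f (\<lambda>v. v \<in> centered_vecs n) (vec n x0)"
    unfolding is_arg_min_linorder f0
  proof (intro conjI allI impI c0)
    fix v assume "v \<in> centered_vecs n"
    then have v: "v \<in> carrier_vec n" "(\<Sum>i<n. v $ i) = 0" by (simp_all add: centered_vecs_iff)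
    show "objective n E L \<rho> y x0 \<le> ?f v" unfolding objective_vec[OF v(1)] by (rule min[OF v(2)])
  qed
  then have arg: "is_arg_min ?f (\<lambda>v. v \<in> centered_vecs n) (reg_mle n E L \<rho> y)"
    unfolding reg_mle_def arg_min_on_def arg_min_def by (rule someI)
  then show c: "reg_mle n E L \<rho> y \<in> centered_vecs n" by (simp add: is_arg_min_linorder)
  assume x: "(\<Sum>i<n. x i) = 0"
  have carrier: "reg_mle n E L \<rho> y \<in> carrier_vec n" using c by (simp add: centered_vecs_iff)
  have "?f (reg_mle n E L \<rho> y) \<le> ?f (vec n x0)" using arg c0 unfolding is_arg_min_linorder by blast
  then have "objective n E L \<rho> y (\<lambda>i. reg_mle n E L \<rho> y $ i) \<le> objective n E L \<rho> y x0"
    unfolding f0 objective_vec[OF carrier] .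
  also have "\<dots> \<le> objective n E L \<rho> y x" by (rule min[OF x])
  finally show "objective n E L \<rho> y (\<lambda>i. reg_mle n E L \<rho> y $ i) \<le> objective n E L \<rho> y x" .
qed

lemma log_likelihood_term_deriv:
  "((\<lambda>t. q * ln (logistic (a + t * b)) + (1 - q) * ln (1 - logistic (a + t * b)))
     has_real_derivative (q - logistic a) * b) (at 0)"
proof -
  have pos: "logistic a > 0" "1 - logistic a > 0"
    using logistic_pos[of a] logistic_less_1[of a] by auto
  have lin: "((\<lambda>t. a + t * b) has_real_derivative b) (at 0)"
    by (auto intro!: derivative_eq_intros)
  have d: "((\<lambda>t. logistic (a + t * b)) has_real_derivative logistic a * (1 - logistic a) * b) (at 0)"
    using logistic_deriv[OF lin] by simp
  have "((\<lambda>t. ln (logistic (a + t * b))) has_real_derivative (1 - logistic a) * b) (at 0)"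
    using DERIV_chain2[OF DERIV_ln_divide, of "\<lambda>t. logistic (a + t * b)" 0, OF _ d] pos by simp
  moreover have "((\<lambda>t. ln (1 - logistic (a + t * b))) has_real_derivative - logistic a * b) (at 0)"
    using DERIV_chain2[OF DERIV_ln_divide, of "\<lambda>t. 1 - logistic (a + t * b)" 0, OF _ DERIV_diff[OF DERIV_const d]] pos
    by simp
  ultimately have "((\<lambda>t. q * ln (logistic (a + t * b)) + (1 - q) * ln (1 - logistic (a + t * b)))
     has_real_derivative q * ((1 - logistic a) * b) + (1 - q) * (- logistic a * b)) (at 0)"
    by (intro DERIV_add DERIV_cmult)
  moreover have "q * ((1 - logistic a) * b) + (1 - q) * (- logistic a * b) = (q - logistic a) * b"
    by (simp add: algebra_simps)
  ultimately show ?thesis by simp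
qed

lemma objective_deriv:
  "((\<lambda>t. objective n E L \<rho> y (\<lambda>i. x i + t * w i)) has_real_derivative
      - (\<Sum>j<n. \<Sum>i<j. adj E i j * ((mean_outcome L y i j - logistic (x i - x j)) * (w i - w j)))
      + \<rho> * (\<Sum>i<n. x i * w i)) (at 0)"
proof -
  have shift: "x i + t * w i - (x j + t * w j) = (x i - x j) + t * (w i - w j)" for i j t
    by (simp add: algebra_simps)
  have sq: "((\<lambda>t. (x i + t * w i)\<^sup>2) has_real_derivative 2 * (x i * w i)) (at 0)" for i
    by (auto intro!: derivative_eq_intros)
  have "((\<lambda>t. objective n E L \<rho> y (\<lambda>i. x i + t * w i)) has_real_derivative
      - (\<Sum>j<n. \<Sum>i<j. adj E i j * ((mean_outcome L y i j - logistic (x i - x j)) * (w i - w j)))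
      + \<rho> / 2 * (\<Sum>i<n. 2 * (x i * w i))) (at 0)"
    unfolding objective_def shift
    by (intro DERIV_add DERIV_minus DERIV_sum DERIV_cmult log_likelihood_term_deriv sq)
  then show ?thesis by (simp add: sum_distrib_left[symmetric])
qed

text \<open>
  The first-order condition holds in all coordinates, although only centred vectors compete: the gradient
  of the likelihood sums to 0 because the likelihood depends only on differences, and the penalty contributes
  \<open>\<rho>\<close> times a centred vector. So the gradient is itself a feasible direction, and it is orthogonal to all
  feasible directions.
\<close>

lemma reg_mle_balance:
  fixes \<theta> :: "real vec" and L :: nat and y :: "nat \<times> nat \<times> nat \<Rightarrow> bool"
  assumes graph: "simple_graph n E" and \<rho>: "\<rho> > 0" and m: "m < n"
  defines "x \<equiv> reg_mle n E L \<rho> y"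
  shows "(\<Sum>j<n. adj E m j * (logistic (x $ m - x $ j) - logistic (\<theta> $ m - \<theta> $ j)))
      + \<rho> * (x $ m - \<theta> $ m) = score n E L \<theta> y m - \<rho> * \<theta> $ m"
proof -
  have x0: "(\<Sum>i<n. x $ i) = 0"
    using reg_mle_minimizes(1)[OF \<rho>] by (simp add: x_def centered_vecs_iff)
  define D where "D = (\<lambda>i j. logistic (x $ i - x $ j) - logistic (\<theta> $ i - \<theta> $ j))"
  define R where "R = (\<lambda>i j. adj E i j * (noise L \<theta> y i j - D i j))"
  define h where "h = (\<lambda>i. (\<Sum>j<n. R i j) - \<rho> * x $ i)"
  have D_antisym: "D i j = - D j i" for i j
    using logistic_minus[of "x $ i - x $ j"] logistic_minus[of "\<theta> $ i - \<theta> $ j"] by (simp add: D_def)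
  have R_antisym: "R i j = - R j i" for i j
    unfolding R_def adj_sym[OF graph, of i j] noise_antisym[of L \<theta> y i j] D_antisym[of i j]
    by (simp add: algebra_simps)
  have pairing: "(\<Sum>i<n. w i * (\<Sum>j<n. R i j)) = (\<Sum>j<n. \<Sum>i<j. R i j * (w i - w j))" for w
    by (rule sum_antisymmetric_pairing) (rule R_antisym)
  have h0: "(\<Sum>i<n. h i) = 0"
    using pairing[of "\<lambda>_. 1"] x0 by (simp add: h_def sum_subtractf sum_distrib_left[symmetric])
  have "(\<Sum>i<n. w i * h i) = 0" if w0: "(\<Sum>i<n. w i) = 0" for w
  proof -
    have "- (\<Sum>j<n. \<Sum>i<j. adj E i j * ((mean_outcome L y i j - logistic (x $ i - x $ j)) * (w i - w j)))
      + \<rho> * (\<Sum>i<n. x $ i * w i) = 0"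
    proof (rule DERIV_local_min[OF objective_deriv[of n E L \<rho> y "\<lambda>i. x $ i" w], of 1])
      have "objective n E L \<rho> y (\<lambda>i. x $ i) \<le> objective n E L \<rho> y (\<lambda>i. x $ i + t * w i)" for t
        unfolding x_def
        by (rule reg_mle_minimizes(2)[OF \<rho>])
           (use x0 w0 in \<open>simp add: x_def sum.distrib sum_distrib_left[symmetric]\<close>)
      then show "\<forall>t. \<bar>0 - t\<bar> < 1 \<longrightarrow> objective n E L \<rho> y (\<lambda>i. x $ i + 0 * w i)
          \<le> objective n E L \<rho> y (\<lambda>i. x $ i + t * w i)" by simp
    qed simp
    moreover have "(\<Sum>j<n. \<Sum>i<j. adj E i j * ((mean_outcome L y i j - logistic (x $ i - x $ j)) * (w i - w j)))
        = (\<Sum>j<n. \<Sum>i<j. R i j * (w i - w j))"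
      by (intro sum.cong refl) (simp add: R_def noise_def D_def)
    moreover have "(\<Sum>i<n. w i * h i) = (\<Sum>i<n. w i * (\<Sum>j<n. R i j)) - \<rho> * (\<Sum>i<n. x $ i * w i)"
      by (simp add: h_def right_diff_distrib sum_subtractf sum_distrib_left mult_ac)
    ultimately show ?thesis by (simp add: pairing)
  qed
  from this[OF h0] have "h m = 0" using m by (simp add: sum_nonneg_eq_0_iff)
  moreover have "(\<Sum>j<n. R m j) = score n E L \<theta> y m - (\<Sum>j<n. adj E m j * D m j)"
    by (simp add: R_def score_def right_diff_distrib sum_subtractf)
  ultimately show ?thesis by (simp add: h_def D_def right_diff_distrib)
qed

section \<open>Rates\<close>

text \<open>
  The right-hand side of the uniform bound and, below, of the Euclidean bound; \<open>w\<close> stands for \<open>\<rho> \<kappa>\<close>.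
\<close>

definition uniform_rate :: "real \<Rightarrow> real \<Rightarrow> real \<Rightarrow> real \<Rightarrow> real \<Rightarrow> real \<Rightarrow> real \<Rightarrow> real \<Rightarrow> real" where
  "uniform_rate n L lam nmax nmin \<kappa>E r w =
     exp (2 * \<kappa>E) / lam * (nmax / nmin) * (sqrt ((n + r) / L) + w * sqrt (n / nmax))
     + exp \<kappa>E / lam * sqrt (nmax * (ln n + r) / L)"

definition euclidean_rate :: "real \<Rightarrow> real \<Rightarrow> real \<Rightarrow> real \<Rightarrow> real \<Rightarrow> real \<Rightarrow> real \<Rightarrow> real" where
  "euclidean_rate n L lam nmax \<kappa>E r w =
     exp \<kappa>E / lam * (sqrt (nmax * (n + r) / L) + w * sqrt n)"

text \<open>
  The bounds of \<open>balanced_error_bounds\<close> for the norms of \<open>g\<close> of a typical sample, expressed by the rates.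
  A factor \<open>1 / sqrt n\<^sub>m\<^sub>i\<^sub>n\<close> is absorbed by \<open>sqrt (n\<^sub>m\<^sub>a\<^sub>x / n\<^sub>m\<^sub>i\<^sub>n) \<le> n\<^sub>m\<^sub>a\<^sub>x / n\<^sub>m\<^sub>i\<^sub>n\<close> in the first term of the
  uniform rate, and \<open>1 / n\<^sub>m\<^sub>i\<^sub>n \<le> 2 / \<lambda>\<^sub>2\<close> produces the second term.
\<close>

lemma rate_bounds:
  fixes n L lam nmax nmin \<kappa>E r w :: real
  assumes "n \<ge> 1" "L > 0" "lam > 0" "0 < nmin" "nmin \<le> nmax" "nmax \<le> n" "lam \<le> 2 * nmin"
    "\<kappa>E \<ge> 0" "r \<ge> 0" "w \<ge> 0"
  defines "Q \<equiv> 12 * exp \<kappa>E / lam * (sqrt (4 * n * nmax / L) + w * sqrt n)"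
  shows "Q \<le> 24 * euclidean_rate n L lam nmax \<kappa>E r w"
    and "Q / sqrt nmin \<le> 24 * uniform_rate n L lam nmax nmin \<kappa>E r w"
    and "12 * exp \<kappa>E * (sqrt (5 / 2 * ln n / (nmin * L)) + w / nmin) \<le> 48 * uniform_rate n L lam nmax nmin \<kappa>E r w"
proof -
  define e where "e = exp \<kappa>E"
  have e: "e \<ge> 1" "exp (2 * \<kappa>E) = e * e" using assms by (simp_all add: e_def flip: exp_add)
  have "e \<le> e * e" using e(1) by simp
  have nmax: "nmax > 0" using assms by simp
  define q where "q = nmax / nmin"
  have q: "q \<ge> 1" using assms by (simp add: q_def)
  have sq: "sqrt q \<le> q" using q real_sqrt_le_mono[of q "q * q"] by (simp add: mult_le_cancel_left1)
  define a where "a = sqrt ((n + r) / L)"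
  define b where "b = w * sqrt (n / nmax)"
  define c where "c = sqrt (nmax * (ln n + r) / L)"
  have nonneg: "a \<ge> 0" "b \<ge> 0" "c \<ge> 0" using assms nmax by (simp_all add: a_def b_def c_def)
  have qab: "0 \<le> q * a" "0 \<le> q * b" using nonneg q by simp_all
  have U: "uniform_rate n L lam nmax nmin \<kappa>E r w = e * e / lam * q * (a + b) + e / lam * c"
    by (simp add: uniform_rate_def e(2) q_def a_def b_def c_def e_def)
  have four: "sqrt (4 * n * nmax / L) = 2 * sqrt (nmax * n / L)"
    using real_sqrt_mult[of 4 "nmax * n / L"] by (simp add: mult_ac)
  have mono: "sqrt (nmax * n / L) \<le> sqrt (nmax * (n + r) / L)"
    using assms nmax by (intro real_sqrt_le_mono divide_right_mono mult_left_mono) auto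
  have "Q \<le> 12 * exp \<kappa>E / lam * (2 * sqrt (nmax * (n + r) / L) + 2 * (w * sqrt n))"
    unfolding Q_def four using assms mono by (intro mult_left_mono add_mono) auto
  then show "Q \<le> 24 * euclidean_rate n L lam nmax \<kappa>E r w"
    by (simp add: euclidean_rate_def algebra_simps add_divide_distrib)
  have s1: "sqrt (4 * n * nmax / L) / sqrt nmin \<le> 2 * (q * a)"
  proof -
    have "sqrt (nmax * n / L) / sqrt nmin = sqrt q * sqrt (n / L)"
      by (simp add: q_def real_sqrt_divide[symmetric] real_sqrt_mult[symmetric] mult_ac)
    also have "\<dots> \<le> q * a"
      unfolding a_def using assms q sq by (intro mult_mono real_sqrt_le_mono divide_right_mono) auto
    finally show ?thesis by (simp add: four)
  qed
  have s2: "w * sqrt n / sqrt nmin \<le> q * b"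
  proof -
    have "sqrt n / sqrt nmin = sqrt q * sqrt (n / nmax)"
      using nmax by (simp add: q_def real_sqrt_divide[symmetric] real_sqrt_mult[symmetric])
    then have "w * sqrt n / sqrt nmin = sqrt q * b" by (simp add: b_def mult_ac times_divide_eq_right[symmetric] del: times_divide_eq_right)
    also have "\<dots> \<le> q * b" using sq nonneg by (intro mult_right_mono)
    finally show ?thesis .
  qed
  have "Q / sqrt nmin = 12 * e / lam * (sqrt (4 * n * nmax / L) / sqrt nmin + w * sqrt n / sqrt nmin)"
    unfolding Q_def e_def add_divide_distrib[symmetric] by simp
  also have "\<dots> \<le> 12 * e / lam * (2 * (q * a) + q * b)"
    using s1 s2 e(1) assms by (intro mult_left_mono add_mono) auto
  also have "\<dots> \<le> 12 * (e * e) / lam * (2 * (q * a) + 2 * (q * b))"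
  proof (rule mult_mono)
    show "12 * e / lam \<le> 12 * (e * e) / lam"
      using \<open>e \<le> e * e\<close> assms by (intro divide_right_mono) auto
    show "2 * (q * a) + q * b \<le> 2 * (q * a) + 2 * (q * b)"
      using qab by linarith
    show "0 \<le> 12 * (e * e) / lam" using assms by simp
    show "0 \<le> 2 * (q * a) + q * b" using qab by linarith
  qed
  also have "\<dots> = 24 * (e * e / lam * q * (a + b))" by (simp add: algebra_simps add_divide_distrib)
  also have "\<dots> \<le> 24 * uniform_rate n L lam nmax nmin \<kappa>E r w"
    unfolding U using nonneg e(1) assms by simp
  finally show "Q / sqrt nmin \<le> 24 * uniform_rate n L lam nmax nmin \<kappa>E r w" .
  have inv: "1 / nmin \<le> 2 / lam" using assms by (simp add: field_simps)
  have t1: "sqrt (5 / 2 * ln n / (nmin * L)) \<le> 4 / lam * c"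
  proof -
    have "5 / 2 * ln n / (nmin * L) \<le> 4 * (nmax * (ln n + r) / L) / (nmin * nmin)"
    proof -
      have "5 / 2 * ln n / (nmin * L) \<le> 4 * (ln n + r) / (nmin * L)"
        using assms by (intro divide_right_mono) auto
      also have "\<dots> = 4 * (nmin * (ln n + r) / L) / (nmin * nmin)"
        using assms by (simp add: field_simps)
      also have "\<dots> \<le> 4 * (nmax * (ln n + r) / L) / (nmin * nmin)"
        using assms by (intro divide_right_mono mult_left_mono mult_right_mono) auto
      finally show ?thesis .
    qed
    then have "sqrt (5 / 2 * ln n / (nmin * L)) \<le> sqrt (4 * (nmax * (ln n + r) / L) / (nmin * nmin))"
      by (rule real_sqrt_le_mono)
    also have "\<dots> = 2 * c * (1 / nmin)"
      using assms by (simp add: c_def real_sqrt_divide real_sqrt_mult)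
    also have "\<dots> \<le> 2 * c * (2 / lam)" using nonneg inv by (intro mult_left_mono) auto
    finally show ?thesis by simp
  qed
  have t2: "w / nmin \<le> 2 / lam * (q * b)"
  proof -
    have "1 \<le> q * sqrt (n / nmax)"
      using q assms nmax by (intro order_trans[OF _ mult_mono[of 1 q 1]]) auto
    then have "w * 1 \<le> w * (q * sqrt (n / nmax))" using assms by (intro mult_left_mono)
    then have "w \<le> q * b" by (simp add: b_def mult_ac)
    then have "1 / nmin * w \<le> 2 / lam * (q * b)" using inv assms by (intro mult_mono) auto
    then show ?thesis by simp
  qed
  have "12 * e * (sqrt (5 / 2 * ln n / (nmin * L)) + w / nmin) \<le> 12 * e * (4 / lam * c + 2 / lam * (q * b))"
    using t1 t2 e(1) by (intro mult_left_mono add_mono) auto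
  also have "\<dots> = 48 * (e / lam * c) + 24 * (e / lam * (q * b))" by (simp add: algebra_simps add_divide_distrib)
  also have "\<dots> \<le> 48 * (e / lam * c) + 48 * (e * e / lam * (q * (a + b)))"
  proof (intro add_mono order_refl)
    have "e / lam * (q * b) \<le> e * e / lam * (q * (a + b))"
    proof (rule mult_mono)
      show "e / lam \<le> e * e / lam" using \<open>e \<le> e * e\<close> assms by (intro divide_right_mono) auto
      show "q * b \<le> q * (a + b)" using qab by (simp add: distrib_left)
      show "0 \<le> e * e / lam" using assms by simp
    qed (rule qab)
    moreover have "0 \<le> e * e / lam * (q * (a + b))" using assms qab by (simp add: distrib_left)
    moreover have "24 * s \<le> 48 * t" if "s \<le> t" "0 \<le> t" for s t :: real using that by linarith
    ultimately show "24 * (e / lam * (q * b)) \<le> 48 * (e * e / lam * (q * (a + b)))" by blast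
  qed
  also have "\<dots> = 48 * uniform_rate n L lam nmax nmin \<kappa>E r w" unfolding U by (simp add: algebra_simps add_divide_distrib)
  finally show "12 * exp \<kappa>E * (sqrt (5 / 2 * ln n / (nmin * L)) + w / nmin) \<le> 48 * uniform_rate n L lam nmax nmin \<kappa>E r w"
    by (simp add: e_def)
qed

text \<open>
  On the typical samples of \<open>score_concentration\<close> the estimator satisfies both bounds. The threshold
  \<open>1 / 200\<close> suffices for the two smallness conditions of \<open>balanced_error_bounds\<close>:
  \<open>24 / 200 \<le> 1 / 6\<close> and \<open>48 / 200 < 1 / 4\<close>.
\<close>

lemma reg_mle_error:
  fixes n :: nat and E :: "(nat \<times> nat) set" and \<theta> :: "real vec" and L :: nat and y :: "nat \<times> nat \<times> nat \<Rightarrow> bool"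
  defines "lam \<equiv> second_smallest_eigenvalue (laplacian n E)"
  assumes graph: "simple_graph n E" and n: "n \<ge> 2" and L: "L \<ge> 1" and \<theta>: "\<theta> \<in> centered_vecs n"
    and lam: "lam > 0" and \<rho>: "\<rho> > 0"
    and deg: "0 < nmin" "\<And>i. i < n \<Longrightarrow> nmin \<le> node_degree n E i" "nmin \<le> nmax" "nmax \<le> real n" "lam \<le> 2 * nmin"
    and \<kappa>E: "\<kappa>E \<ge> 0" "\<And>i j. (i, j) \<in> E \<Longrightarrow> \<bar>\<theta> $ i - \<theta> $ j\<bar> \<le> \<kappa>E"
    and \<kappa>: "\<And>i. i < n \<Longrightarrow> \<bar>\<theta> $ i\<bar> \<le> \<kappa>" and r: "r \<ge> 0"
    and norm: "(\<Sum>i<n. (score n E L \<theta> y i)\<^sup>2) \<le> 4 * real n * nmax / real L"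
    and coord: "\<And>m. m < n \<Longrightarrow> \<bar>score n E L \<theta> y m\<bar> \<le> sqrt (5 / 2 * node_degree n E m * ln (real n) / real L)"
    and small: "uniform_rate (real n) (real L) lam nmax nmin \<kappa>E r (\<rho> * \<kappa>) < 1 / 200"
  shows "linf_norm (reg_mle n E L \<rho> y - \<theta>) \<le> 144 * uniform_rate (real n) (real L) lam nmax nmin \<kappa>E r (\<rho> * \<kappa>)"
    and "l2_norm (reg_mle n E L \<rho> y - \<theta>) \<le> 48 * euclidean_rate (real n) (real L) lam nmax \<kappa>E r (\<rho> * \<kappa>)"
proof -
  define x where "x = reg_mle n E L \<rho> y"
  define \<delta> where "\<delta> = (\<lambda>i. x $ i - \<theta> $ i)"
  define g where "g = (\<lambda>i. score n E L \<theta> y i - \<rho> * \<theta> $ i)"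
  define D where "D = (\<lambda>i j. logistic (x $ i - x $ j) - logistic (\<theta> $ i - \<theta> $ j))"
  define \<beta> where "\<beta> = exp (- \<kappa>E) / 12"
  define U where "U = uniform_rate (real n) (real L) lam nmax nmin \<kappa>E r (\<rho> * \<kappa>)"
  define Q where "Q = 12 * exp \<kappa>E / lam * (sqrt (4 * real n * nmax / real L) + \<rho> * \<kappa> * sqrt (real n))"
  define V where "V = 12 * exp \<kappa>E * (sqrt (5 / 2 * ln (real n) / (nmin * real L)) + \<rho> * \<kappa> / nmin)"
  have x: "x \<in> carrier_vec n" "(\<Sum>i<n. x $ i) = 0" and \<theta>0: "\<theta> \<in> carrier_vec n" "(\<Sum>i<n. \<theta> $ i) = 0"
    using reg_mle_minimizes(1)[OF \<rho>] \<theta> by (simp_all add: x_def centered_vecs_iff)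
  have "exp \<kappa>E * exp (- \<kappa>E) = 1" by (simp flip: exp_add)
  then have \<beta>: "\<beta> > 0" "1 / \<beta> = 12 * exp \<kappa>E" by (simp_all add: \<beta>_def divide_eq_eq)
  have \<kappa>0: "\<kappa> \<ge> 0" using \<kappa>[of 0] n by simp
  have rates: "Q \<le> 24 * euclidean_rate (real n) (real L) lam nmax \<kappa>E r (\<rho> * \<kappa>)"
    "Q / sqrt nmin \<le> 24 * U" "V \<le> 48 * U"
    unfolding Q_def U_def V_def
    by (rule rate_bounds; use n L lam deg \<kappa>E r \<rho> \<kappa>0 in simp)+
  have g_l2: "sqrt (\<Sum>i<n. (g i)\<^sup>2) / (\<beta> * lam) \<le> Q"
  proof -
    have "sqrt (\<Sum>i<n. (g i)\<^sup>2) \<le> sqrt (\<Sum>i<n. (score n E L \<theta> y i)\<^sup>2) + sqrt (\<Sum>i<n. (\<rho> * \<theta> $ i)\<^sup>2)"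
      using L2_set_triangle_ineq[of "score n E L \<theta> y" "\<lambda>i. - (\<rho> * \<theta> $ i)" "{..<n}"]
      by (simp add: L2_set_def g_def)
    also have "\<dots> \<le> sqrt (4 * real n * nmax / real L) + \<rho> * \<kappa> * sqrt (real n)"
    proof (intro add_mono real_sqrt_le_mono norm)
      have "(\<Sum>i<n. (\<rho> * \<theta> $ i)\<^sup>2) \<le> (\<Sum>i<n. (\<rho> * \<kappa>)\<^sup>2)"
        using \<kappa> \<rho> \<kappa>0 by (intro sum_mono) (simp add: abs_le_square_iff[symmetric] abs_mult)
      then have "sqrt (\<Sum>i<n. (\<rho> * \<theta> $ i)\<^sup>2) \<le> sqrt (real n * (\<rho> * \<kappa>)\<^sup>2)"
        by (intro real_sqrt_le_mono) simp
      then show "sqrt (\<Sum>i<n. (\<rho> * \<theta> $ i)\<^sup>2) \<le> \<rho> * \<kappa> * sqrt (real n)"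
        using \<rho> \<kappa>0 by (simp add: real_sqrt_mult mult.commute)
    qed
    finally have "1 / \<beta> * (1 / lam * sqrt (\<Sum>i<n. (g i)\<^sup>2))
        \<le> 1 / \<beta> * (1 / lam * (sqrt (4 * real n * nmax / real L) + \<rho> * \<kappa> * sqrt (real n)))"
      using \<beta>(1) lam by (intro mult_left_mono) auto
    then show ?thesis unfolding \<beta>(2) Q_def by (simp add: \<beta>(2)[symmetric] divide_simps)
  qed
  have g_max: "\<bar>g m\<bar> / (\<beta> * node_degree n E m) \<le> V" if m: "m < n" for m
  proof -
    define d where "d = node_degree n E m"
    have d: "d > 0" "nmin \<le> d" using deg(1) deg(2)[OF m] by (simp_all add: d_def)
    have "\<bar>g m\<bar> \<le> sqrt (5 / 2 * d * ln (real n) / real L) + \<rho> * \<kappa>"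
    proof -
      have "\<bar>\<rho> * \<theta> $ m\<bar> \<le> \<rho> * \<kappa>" using \<kappa>[OF m] \<rho> by (simp add: abs_mult)
      then show ?thesis using coord[OF m] unfolding g_def d_def by linarith
    qed
    then have "\<bar>g m\<bar> / d \<le> sqrt (5 / 2 * d * ln (real n) / real L) / d + \<rho> * \<kappa> / d"
      using d by (simp add: add_divide_distrib[symmetric] divide_right_mono)
    also have "\<dots> \<le> sqrt (5 / 2 * ln (real n) / (nmin * real L)) + \<rho> * \<kappa> / nmin"
    proof (rule add_mono)
      have "sqrt z / d = sqrt (z / (d * d))" for z using d by (simp add: real_sqrt_divide)
      then have "sqrt (5 / 2 * d * ln (real n) / real L) / d = sqrt (5 / 2 * d * ln (real n) / real L / (d * d))" .
      also have "5 / 2 * d * ln (real n) / real L / (d * d) = 5 / 2 * ln (real n) / (d * real L)"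
        using d by simp
      also have "sqrt \<dots> \<le> sqrt (5 / 2 * ln (real n) / (nmin * real L))"
        using d deg(1) n L by (intro real_sqrt_le_mono divide_left_mono mult_right_mono mult_pos_pos) auto
      finally show "sqrt (5 / 2 * d * ln (real n) / real L) / d \<le> sqrt (5 / 2 * ln (real n) / (nmin * real L))" .
      show "\<rho> * \<kappa> / d \<le> \<rho> * \<kappa> / nmin"
        using d deg(1) \<rho> \<kappa>0 by (intro divide_left_mono mult_pos_pos) auto
    qed
    finally have "1 / \<beta> * (\<bar>g m\<bar> / d) \<le> V"
      unfolding V_def \<beta>(2) by (intro mult_left_mono) auto
    then show ?thesis by (simp add: d_def)
  qed
  have rayleigh: "lam * (\<Sum>i<n. (\<delta> i)\<^sup>2) \<le> dirichlet n E \<delta>"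
    unfolding lam_def using x(2) \<theta>0(2)
    by (intro second_smallest_eigenvalue_le_dirichlet[OF graph n]) (simp add: \<delta>_def sum_subtractf)
  have antisym: "D i j = - D j i" for i j
    using logistic_minus[of "x $ i - x $ j"] logistic_minus[of "\<theta> $ i - \<theta> $ j"] by (simp add: D_def)
  have lower: "\<beta> * min (\<delta> i - \<delta> j) 1 \<le> D i j" if "(i, j) \<in> E" "\<delta> j \<le> \<delta> i" for i j
  proof -
    have "\<theta> $ i - \<theta> $ j + (\<delta> i - \<delta> j) = x $ i - x $ j" by (simp add: \<delta>_def)
    then show ?thesis
      using logistic_increment_lower[OF \<kappa>E(2)[OF that(1)], of "\<delta> i - \<delta> j"] that(2)
      by (simp add: \<beta>_def D_def)
  qed
  have balance: "(\<Sum>j<n. adj E i j * D i j) + \<rho> * \<delta> i = g i" if "i < n" for i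
    using reg_mle_balance[OF graph \<rho> that] by (simp add: D_def \<delta>_def g_def x_def)
  have Usmall: "U < 1 / 200" using small by (simp add: U_def)
  have cond_l2: "sqrt (\<Sum>i<n. (g i)\<^sup>2) / (\<beta> * lam) \<le> sqrt (node_degree n E i) / 6" if "i < n" for i
  proof -
    have "Q / sqrt nmin \<le> 1 / 6" using rates(2) Usmall by simp
    then have "Q \<le> sqrt nmin / 6" using deg(1) by (simp add: field_simps)
    also have "\<dots> \<le> sqrt (node_degree n E i) / 6" using deg(2)[OF that] by simp
    finally show ?thesis by (rule order_trans[OF g_l2])
  qed
  have cond_max: "\<bar>g i\<bar> < \<beta> * node_degree n E i / 4" if "i < n" for i
  proof -
    have "48 * U < 1 / 4" using Usmall by simp
    then have "\<bar>g i\<bar> / (\<beta> * node_degree n E i) < 1 / 4"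
      by (rule le_less_trans[OF order_trans[OF g_max[OF that] rates(3)]])
    moreover have "\<beta> * node_degree n E i > 0" using \<beta>(1) deg(1) deg(2)[OF that] by simp
    ultimately show ?thesis by (simp add: pos_divide_less_eq)
  qed
  have degpos: "0 < node_degree n E i" if "i < n" for i using deg(1) deg(2)[OF that] by linarith
  have npos: "n > 0" using n by simp
  have \<rho>0: "\<rho> \<ge> 0" using \<rho> by simp
  note stable = balanced_error_bounds[OF graph npos \<beta>(1) lam \<rho>0 rayleigh antisym lower balance degpos cond_l2 cond_max]
  have l2: "sqrt (\<Sum>i<n. (\<delta> i)\<^sup>2) \<le> 2 * Q"
    using stable(1) mult_left_mono[OF g_l2, of 2] by (simp only: times_divide_eq_right) simp
  have dim: "dim_vec (reg_mle n E L \<rho> y - \<theta>) = n" using \<theta>0(1) by simp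
  have idx: "(reg_mle n E L \<rho> y - \<theta>) $ i = \<delta> i" if "i < n" for i
    using that \<theta>0(1) by (simp add: \<delta>_def x_def)
  have "l2_norm (reg_mle n E L \<rho> y - \<theta>) = sqrt (\<Sum>i<n. (\<delta> i)\<^sup>2)"
    by (simp add: l2_norm_def scalar_prod_def dim lessThan_atLeast0 idx power2_eq_square del: index_minus_vec)
  then show "l2_norm (reg_mle n E L \<rho> y - \<theta>) \<le> 48 * euclidean_rate (real n) (real L) lam nmax \<kappa>E r (\<rho> * \<kappa>)"
    using l2 rates(1) by simp
  obtain m where m: "m < n" and bound: "\<And>i. i < n \<Longrightarrow> \<bar>\<delta> i\<bar> \<le>
      sqrt (\<Sum>i<n. (\<delta> i)\<^sup>2) / sqrt (node_degree n E m) + 2 * \<bar>g m\<bar> / (\<beta> * node_degree n E m)"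
    using stable(2) by auto
  have "\<bar>\<delta> i\<bar> \<le> 144 * U" if "i < n" for i
  proof -
    have "sqrt (\<Sum>i<n. (\<delta> i)\<^sup>2) / sqrt (node_degree n E m) \<le> sqrt (\<Sum>i<n. (\<delta> i)\<^sup>2) / sqrt nmin"
      using deg(1) deg(2)[OF m] by (intro divide_left_mono mult_pos_pos) (auto simp: sum_nonneg)
    also have "\<dots> \<le> 2 * Q / sqrt nmin" using l2 deg(1) by (intro divide_right_mono) auto
    finally have "sqrt (\<Sum>i<n. (\<delta> i)\<^sup>2) / sqrt (node_degree n E m) \<le> 48 * U" using rates(2) by simp
    moreover have "2 * \<bar>g m\<bar> / (\<beta> * node_degree n E m) \<le> 96 * U"
      using mult_left_mono[OF order_trans[OF g_max[OF m] rates(3)], of 2] by simp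
    ultimately show ?thesis using bound[OF that] by linarith
  qed
  then show "linf_norm (reg_mle n E L \<rho> y - \<theta>) \<le> 144 * uniform_rate (real n) (real L) lam nmax nmin \<kappa>E r (\<rho> * \<kappa>)"
    unfolding linf_norm_def dim U_def[symmetric] using npos
    by (subst Max_le_iff) (auto simp: idx simp del: index_minus_vec)
qed

text \<open>
  A centred vector has entries on both sides of 0: \<open>n \<theta> i\<close> is the sum of the differences \<open>\<theta> i - \<theta> j\<close>.
\<close>

lemma abs_le_dyn_range:
  assumes "\<theta> \<in> centered_vecs n" "i < n"
  shows "\<bar>\<theta> $ i\<bar> \<le> dyn_range n \<theta>"
proof -
  have diff: "\<bar>\<theta> $ i - \<theta> $ j\<bar> \<le> dyn_range n \<theta>" if "j < n" for j
    unfolding dyn_range_def using assms(2) that by (intro Max_ge) (auto intro!: image_eqI[of _ _ "(i, j)"])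
  have "real n * \<theta> $ i = (\<Sum>j<n. \<theta> $ i - \<theta> $ j)"
    using assms(1) by (simp add: centered_vecs_iff sum_subtractf)
  then have "real n * \<bar>\<theta> $ i\<bar> = \<bar>\<Sum>j<n. \<theta> $ i - \<theta> $ j\<bar>" by (metis abs_mult abs_of_nat)
  also have "\<dots> \<le> (\<Sum>j<n. \<bar>\<theta> $ i - \<theta> $ j\<bar>)" by (rule sum_abs)
  also have "\<dots> \<le> (\<Sum>j<n. dyn_range n \<theta>)" by (intro sum_mono diff) simp
  also have "\<dots> = real n * dyn_range n \<theta>" by simp
  finally show ?thesis using assms(2) by simp
qed

lemma edge_le_edge_range:
  assumes "simple_graph n E" "(i, j) \<in> E"
  shows "\<bar>\<theta> $ i - \<theta> $ j\<bar> \<le> edge_range E \<theta>"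
proof -
  have "finite E"
    by (rule finite_subset[of _ "{..<n} \<times> {..<n}"]) (use assms(1) in \<open>auto simp: simple_graph_def\<close>)
  then show ?thesis
    unfolding edge_range_def using assms(2) by (intro Max_ge) (auto intro!: image_eqI[of _ _ "(i, j)"])
qed

lemma degree_bounds:
  assumes "simple_graph n E" "n \<ge> 2" "second_smallest_eigenvalue (laplacian n E) > 0"
  shows "0 < min_degree n E" "\<And>i. i < n \<Longrightarrow> min_degree n E \<le> node_degree n E i"
    "\<And>i. i < n \<Longrightarrow> node_degree n E i \<le> max_degree n E"
    "min_degree n E \<le> max_degree n E" "max_degree n E \<le> real n"
    "second_smallest_eigenvalue (laplacian n E) \<le> 2 * min_degree n E"
    "E \<noteq> {}"
proof -
  have "0 \<in> {..<n}" using assms(2) by simp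
  then have ne: "node_degree n E ` {..<n} \<noteq> {}" by blast
  show min_le: "min_degree n E \<le> node_degree n E i" if "i < n" for i
    unfolding min_degree_def using that by (intro Min_le) auto
  show le_max: "node_degree n E i \<le> max_degree n E" if "i < n" for i
    unfolding max_degree_def using that by (intro Max_ge) auto
  show "min_degree n E \<le> max_degree n E" using min_le[of 0] le_max[of 0] assms(2) by simp
  have "node_degree n E i \<le> real n" if "i < n" for i
  proof -
    have "node_degree n E i \<le> (\<Sum>j<n. 1)"
      unfolding node_degree_eq[OF that] by (intro sum_mono adj_le_1)
    then show ?thesis by simp
  qed
  then show "max_degree n E \<le> real n"
    unfolding max_degree_def using ne by (intro Max.boundedI) auto
  have "min_degree n E \<in> node_degree n E ` {..<n}"
    unfolding min_degree_def using ne by (intro Min_in) auto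
  then obtain m where m: "m < n" "min_degree n E = node_degree n E m" by auto
  show lam: "second_smallest_eigenvalue (laplacian n E) \<le> 2 * min_degree n E"
    unfolding m(2) using assms m(1) by (intro second_smallest_eigenvalue_le_degree) auto
  show pos: "0 < min_degree n E" using lam assms(3) by linarith
  show "E \<noteq> {}"
  proof
    assume "E = {}"
    then have "node_degree n E m = 0" using m(1) by (simp add: node_degree_eq adj_def)
    then show False using pos m(2) by simp
  qed
qed

text \<open>
  The bounds may be replaced by any larger numbers \<open>b\<close> and \<open>b'\<close>, which serves both the general rate and the
  one for the special choice of \<open>\<rho>\<close>.
\<close>

lemma reg_mle_error_prob:
  fixes n :: nat and E :: "(nat \<times> nat) set" and \<theta> :: "real vec" and L :: nat and \<rho> :: real
  defines "lam \<equiv> second_smallest_eigenvalue (laplacian n E)"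
  defines "\<kappa> \<equiv> dyn_range n \<theta>" and "\<kappa>E \<equiv> edge_range E \<theta>"
  defines "r \<equiv> range_term \<kappa> \<kappa>E"
  defines "U \<equiv> uniform_rate (real n) (real L) lam (max_degree n E) (min_degree n E) \<kappa>E r (\<rho> * \<kappa>)"
    and "V \<equiv> euclidean_rate (real n) (real L) lam (max_degree n E) \<kappa>E r (\<rho> * \<kappa>)"
  assumes graph: "simple_graph n E" and n: "n \<ge> 2" and L: "L \<ge> 1" and \<theta>: "\<theta> \<in> centered_vecs n"
    and lam: "lam > 0" and \<rho>: "\<rho> > 0" and small: "U < 1 / 200"
    and b: "144 * U \<le> b" and b': "48 * V \<le> b'"
  shows "1 - 258 / real n ^ 4 \<le> measure_pmf.prob (btl_pmf n E L \<theta>)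
     {y. linf_norm (reg_mle n E L \<rho> y - \<theta>) \<le> b \<and> l2_norm (reg_mle n E L \<rho> y - \<theta>) \<le> b'}"
proof -
  note deg = degree_bounds[OF graph n lam[unfolded lam_def]]
  have \<kappa>E: "\<kappa>E \<ge> 0"
  proof -
    obtain i j where "(i, j) \<in> E" using deg(7) by auto
    from edge_le_edge_range[OF graph this, of \<theta>] show ?thesis by (simp add: \<kappa>E_def)
  qed
  then have r: "r \<ge> 0" by (simp add: r_def range_term_def)
  have pos: "0 < node_degree n E i" if "i < n" for i using deg(1) deg(2)[OF that] by linarith
  let ?good = "{y. (\<Sum>i<n. (score n E L \<theta> y i)\<^sup>2) \<le> 4 * real n * max_degree n E / real L \<and>
         (\<forall>m<n. \<bar>score n E L \<theta> y m\<bar> \<le> sqrt (5 / 2 * node_degree n E m * ln (real n) / real L))}"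
  have "1 - 258 / real n ^ 4 \<le> measure_pmf.prob (btl_pmf n E L \<theta>) ?good"
    by (rule score_concentration[OF graph n L pos deg(3)])
  also have "\<dots> \<le> measure_pmf.prob (btl_pmf n E L \<theta>)
      {y. linf_norm (reg_mle n E L \<rho> y - \<theta>) \<le> b \<and> l2_norm (reg_mle n E L \<rho> y - \<theta>) \<le> b'}"
  proof (rule measure_pmf.finite_measure_mono)
    show "?good \<subseteq> {y. linf_norm (reg_mle n E L \<rho> y - \<theta>) \<le> b \<and> l2_norm (reg_mle n E L \<rho> y - \<theta>) \<le> b'}"
    proof (intro subsetI CollectI, elim CollectE conjE)
      fix y
      assume norm: "(\<Sum>i<n. (score n E L \<theta> y i)\<^sup>2) \<le> 4 * real n * max_degree n E / real L"
        and coord: "\<forall>m<n. \<bar>score n E L \<theta> y m\<bar> \<le> sqrt (5 / 2 * node_degree n E m * ln (real n) / real L)"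
      note err = reg_mle_error[OF graph n L \<theta> lam[unfolded lam_def] \<rho> deg(1,2,4,5,6) \<kappa>E
          edge_le_edge_range[OF graph, of _ _ \<theta>, folded \<kappa>E_def] abs_le_dyn_range[OF \<theta>, folded \<kappa>_def] r norm
          coord[rule_format] small[unfolded U_def lam_def], folded lam_def, folded U_def V_def]
      from err b b' show "linf_norm (reg_mle n E L \<rho> y - \<theta>) \<le> b \<and> l2_norm (reg_mle n E L \<rho> y - \<theta>) \<le> b'"
        by linarith
    qed
  qed simp
  finally show ?thesis .
qed

theorem theorem1:
  fixes c\<^sub>\<rho> c' :: real
  assumes "c\<^sub>\<rho> > 0" and "c' > 0"
  shows "\<exists>C>0. \<exists>K>0. \<exists>P>0. \<forall>(n::nat) (E :: (nat \<times> nat) set) (\<theta> :: real vec) (L::nat) (\<rho>::real).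
    let lam2 = second_smallest_eigenvalue (laplacian n E);
        nmax = max_degree n E;
        nmin = min_degree n E;
        \<kappa> = dyn_range n \<theta>;
        \<kappa>\<^sub>E = edge_range E \<theta>;
        r = range_term \<kappa> \<kappa>\<^sub>E;
        linf_bound =
          exp (2 * \<kappa>\<^sub>E) / lam2 * (nmax / nmin) * (sqrt ((real n + r) / real L) + \<rho> * \<kappa> * sqrt (real n / nmax))
          + exp \<kappa>\<^sub>E / lam2 * sqrt (nmax * (ln (real n) + r) / real L);
        l2_bound = exp \<kappa>\<^sub>E / lam2 * (sqrt (nmax * (real n + r) / real L) + \<rho> * \<kappa> * sqrt (real n))
    in n \<ge> 2 \<longrightarrow> L \<ge> 1 \<longrightarrow> simple_graph n E \<longrightarrow> \<theta> \<in> centered_vecs n \<longrightarrow> \<kappa> > 0 \<longrightarrow>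
       lam2 > 0 \<longrightarrow>
       \<rho> \<ge> c\<^sub>\<rho> * (1 / \<kappa>\<^sup>2) * exp (- (5 / 2) * \<kappa>\<^sub>E) * (1 / real n ^ 4) * sqrt nmax \<longrightarrow>
       real L \<le> real n ^ 8 * exp (5 * \<kappa>\<^sub>E) * max 1 \<kappa> \<longrightarrow>
       linf_bound < C \<longrightarrow>
       measure_pmf.prob (btl_pmf n E L \<theta>)
         {y. linf_norm (reg_mle n E L \<rho> y - \<theta>) \<le> K * linf_bound \<and>
             l2_norm (reg_mle n E L \<rho> y - \<theta>) \<le> K * l2_bound} \<ge> 1 - P / real n ^ 4 \<and>
       (\<rho> = c' / \<kappa> * sqrt (nmax / real L) \<longrightarrow>
        measure_pmf.prob (btl_pmf n E L \<theta>)
          {y. linf_norm (reg_mle n E L \<rho> y - \<theta>)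
                \<le> K * (exp (2 * \<kappa>\<^sub>E) / lam2 * (nmax / nmin) * sqrt ((real n + r) / real L)
                       + exp \<kappa>\<^sub>E / lam2 * sqrt (nmax * (ln (real n) + r) / real L)) \<and>
              l2_norm (reg_mle n E L \<rho> y - \<theta>)
                \<le> K * (exp \<kappa>\<^sub>E / lam2 * sqrt (nmax * (real n + r) / real L))} \<ge> 1 - P / real n ^ 4)"
proof (rule exI[of _ "1 / 200"], intro conjI, simp, rule exI[of _ "144 * (1 + c')"], intro conjI,
    (use assms(2) in simp), rule exI[of _ 258], intro conjI, simp, intro allI, unfold Let_def, intro impI, goal_cases)
  case (1 n E \<theta> L \<rho>)
  note n = 1(1) and L = 1(2) and graph = 1(3) and \<theta> = 1(4)
  define lam where "lam = second_smallest_eigenvalue (laplacian n E)"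
  define nmax where "nmax = max_degree n E"
  define nmin where "nmin = min_degree n E"
  define \<kappa> where "\<kappa> = dyn_range n \<theta>"
  define \<kappa>E where "\<kappa>E = edge_range E \<theta>"
  define r where "r = range_term \<kappa> \<kappa>E"
  define U where "U = uniform_rate (real n) (real L) lam nmax nmin \<kappa>E r (\<rho> * \<kappa>)"
  define V where "V = euclidean_rate (real n) (real L) lam nmax \<kappa>E r (\<rho> * \<kappa>)"
  define U0 where "U0 = exp (2 * \<kappa>E) / lam * (nmax / nmin) * sqrt ((real n + r) / real L)
      + exp \<kappa>E / lam * sqrt (nmax * (ln (real n) + r) / real L)"
  define V0 where "V0 = exp \<kappa>E / lam * sqrt (nmax * (real n + r) / real L)"
  define b where "b = 144 * (1 + c')"
  let ?P = "\<lambda>a a'. measure_pmf.prob (btl_pmf n E L \<theta>)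
     {y. linf_norm (reg_mle n E L \<rho> y - \<theta>) \<le> a \<and> l2_norm (reg_mle n E L \<rho> y - \<theta>) \<le> a'} \<ge> 1 - 258 / real n ^ 4"
  note folds = lam_def[symmetric] nmax_def[symmetric] nmin_def[symmetric] \<kappa>_def[symmetric] \<kappa>E_def[symmetric]
  have \<kappa>: "\<kappa> > 0" and lam: "lam > 0" using 1(5,6) by (simp_all add: \<kappa>_def lam_def)
  note deg = degree_bounds[OF graph n lam[unfolded lam_def], folded nmax_def nmin_def lam_def]
  have "0 < c\<^sub>\<rho> * (1 / \<kappa>\<^sup>2) * exp (- (5 / 2) * \<kappa>E) * (1 / real n ^ 4) * sqrt nmax"
    using assms(1) \<kappa> n deg(1,4) by (intro mult_pos_pos) auto
  also have "\<dots> \<le> \<rho>" using 1(7) unfolding folds .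
  finally have \<rho>: "\<rho> > 0" .
  have small: "U < 1 / 200"
    using 1(9) unfolding folds r_def[symmetric] U_def uniform_rate_def .
  have main: "?P a a'" if "144 * U \<le> a" "48 * V \<le> a'" for a a'
    using that by (intro reg_mle_error_prob[OF graph n L \<theta> lam[unfolded lam_def] \<rho>, unfolded folds, unfolded r_def[symmetric], unfolded U_def[symmetric] V_def[symmetric]] small)
  obtain i j where ij: "(i, j) \<in> E" using deg(7) by auto
  have \<kappa>E: "\<kappa>E \<ge> 0" using edge_le_edge_range[OF graph ij, of \<theta>] by (simp add: \<kappa>E_def)
  then have r: "r \<ge> 0" by (simp add: r_def range_term_def)
  have nmax: "nmax > 0" using deg(1,4) by linarith
  have c': "c' > 0" by (rule assms(2))
  have nonneg: "0 \<le> U" "0 \<le> V"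
    using lam deg(1) nmax \<rho> \<kappa> r n by (simp_all add: U_def V_def uniform_rate_def euclidean_rate_def)
  have big: "144 * U \<le> b * U" "48 * V \<le> b * V"
    using c' nonneg by (auto simp: b_def intro!: mult_right_mono)
  have first: "?P (b * U) (b * V)" by (rule main[OF big])
  \<comment> \<open>for this \<open>\<rho>\<close> each regularisation term is at most \<open>c'\<close> times the stochastic term next to it\<close>
  have second: "?P (b * U0) (b * V0)" if rho_eq: "\<rho> = c' / \<kappa> * sqrt (nmax / real L)"
  proof (rule main)
    have w: "\<rho> * \<kappa> = c' * sqrt (nmax / real L)" using rho_eq \<kappa> by simp
    have s1: "\<rho> * \<kappa> * sqrt (real n / nmax) \<le> c' * sqrt ((real n + r) / real L)"
    proof -
      have "sqrt (nmax / real L) * sqrt (real n / nmax) = sqrt (real n / real L)"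
        using nmax by (simp flip: real_sqrt_mult)
      then have "\<rho> * \<kappa> * sqrt (real n / nmax) = c' * sqrt (real n / real L)" by (simp add: w)
      also have "\<dots> \<le> c' * sqrt ((real n + r) / real L)"
        using c' r L by (intro mult_left_mono real_sqrt_le_mono divide_right_mono) auto
      finally show ?thesis .
    qed
    have s2: "\<rho> * \<kappa> * sqrt (real n) \<le> c' * sqrt (nmax * (real n + r) / real L)"
    proof -
      have "sqrt (nmax / real L) * sqrt (real n) = sqrt (nmax * real n / real L)"
        by (simp flip: real_sqrt_mult)
      then have "\<rho> * \<kappa> * sqrt (real n) = c' * sqrt (nmax * real n / real L)" by (simp add: w)
      also have "\<dots> \<le> c' * sqrt (nmax * (real n + r) / real L)"
        using c' r L nmax by (intro mult_left_mono real_sqrt_le_mono divide_right_mono) auto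
      finally show ?thesis .
    qed
    have "U \<le> exp (2 * \<kappa>E) / lam * (nmax / nmin) * (sqrt ((real n + r) / real L) + c' * sqrt ((real n + r) / real L))
      + (1 + c') * (exp \<kappa>E / lam * sqrt (nmax * (ln (real n) + r) / real L))"
      unfolding U_def uniform_rate_def
    proof (rule add_mono)
      show "exp (2 * \<kappa>E) / lam * (nmax / nmin) * (sqrt ((real n + r) / real L) + \<rho> * \<kappa> * sqrt (real n / nmax))
          \<le> exp (2 * \<kappa>E) / lam * (nmax / nmin) * (sqrt ((real n + r) / real L) + c' * sqrt ((real n + r) / real L))"
        using s1 lam nmax deg(1) by (intro mult_left_mono add_left_mono) auto
      define W where "W = exp \<kappa>E / lam * sqrt (nmax * (ln (real n) + r) / real L)"
      have "0 \<le> W" using lam nmax r n by (simp add: W_def)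
      then have "W \<le> (1 + c') * W" using c' by (simp add: distrib_right)
      then show "exp \<kappa>E / lam * sqrt (nmax * (ln (real n) + r) / real L)
          \<le> (1 + c') * (exp \<kappa>E / lam * sqrt (nmax * (ln (real n) + r) / real L))"
        unfolding W_def .
    qed
    also have "\<dots> = (1 + c') * U0" by (simp add: U0_def algebra_simps add_divide_distrib)
    finally have "144 * U \<le> 144 * ((1 + c') * U0)" by (rule mult_left_mono) simp
    then show "144 * U \<le> b * U0" by (simp only: b_def mult.assoc)
    have "V \<le> exp \<kappa>E / lam * (sqrt (nmax * (real n + r) / real L) + c' * sqrt (nmax * (real n + r) / real L))"
      unfolding V_def euclidean_rate_def using s2 lam by (intro mult_left_mono add_left_mono) auto
    also have "\<dots> = (1 + c') * V0" by (simp add: V0_def algebra_simps add_divide_distrib)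
    finally have "48 * V \<le> 48 * ((1 + c') * V0)" by (rule mult_left_mono) simp
    also have "\<dots> \<le> 144 * ((1 + c') * V0)"
      using c' lam nmax r by (intro mult_right_mono) (auto simp: V0_def)
    finally show "48 * V \<le> b * V0" by (simp only: b_def mult.assoc)
  qed
  show ?case
    unfolding folds r_def[symmetric]
    using first second
    unfolding U_def V_def U0_def V0_def uniform_rate_def euclidean_rate_def b_def by blast
qed

end
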